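(* Let $\alpha\in[0,1)$, $r>0$, let $S=(S_u)_{u=0,\dots,T}$ be a nonnegative adapted stock price process, and let $t\in\{1,\ldots,T\}$. Assume that $$P(S_{t-1}=0,\ S_t>0)=0$$ and $$P\left(P\left(\frac{S_t-S_{t-1}}{S_{t-1}} < \kappa_{t,T}\ \Big|\ \mathcal{F}_{t-1}\right)>0\ \text{ or }\ P\left(\frac{S_t-S_{t-1}}{S_{t-1}} \le (1-\alpha)r\ \Big|\ \mathcal{F}_{t-1}\right)=1\right) =1,$$ where $$\kappa_{t,T} := \frac{\left(-\alpha+(1-\alpha)^2 r\right)(1+(1-\alpha)r)^{T-t} + \alpha}{(1+(1-\alpha)r)^{T-t} - \alpha},$$ with the convention $0/0:=0$. Then $S$ satisfies robust local no-arbitrage (RLNA) in period $t$.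
   Context: Setting. Fix $T\in\mathbb{N}=\{1,2,\dots\}$ and a filtered probability space $(\Omega,\mathcal{F},(\mathcal{F}_t)_{t=0,1,\ldots,T},P)$. There is one non-shortable risky stock with price process $S=(S_t)_{t=0,\ldots,T}$, $S_t\in L^0_+(\Omega,\mathcal{F}_t,P)$ (nonnegative real-valued $\mathcal{F}_t$-measurable random variables). The riskless interest rate is a constant $r>0$ and the tax rate a constant $\alpha\in[0,1)$. Strategies. A stock strategy is a family $N=(N_{s,u})_{0\le s\le u\le T}$ with $N_{s,u}\in L^0_+(\Omega,\mathcal{F}_u,P)$ and $N_{s,s}\ge N_{s,s+1}\ge\dots\ge N_{s,T}=0$ for all $s\in\{0,\dots,T\}$ ($N_{s,u}$ is the number of shares bought at time $s$ and still held after trading at time $u$). A pair $(\eta,N)$ with $N$ a stock strategy and $\eta=(\eta_u)_{u=0,\dots,T}$, $\eta_u\in L^0(\Omega,\mathcal{F}_u,P)$, is self-financing for zero initial capital iff, with $\eta_{-1}:=0$, for all $u\in\{0,\dots,T\}$, $$\eta_u-\eta_{u-1}=(1-\alpha)r\,\eta_{u-1}-N_{u,u}S_u+\sum_{s=0}^{u-1}(N_{s,u-1}-N_{s,u})\bigl(S_u-\alpha(S_u-S_s)\bigr).\qquad( * )$$ It is an arbitrage iff $P(\eta_T\ge0)=1$ and $P(\eta_T>0)>0$. The model (or the price process $S$) satisfies no-arbitrage (NA) iff no arbitrage exists. Model with eliminated period $t\in\{1,\dots,T\}$. The time domain is $D=\{0,\dots,t-1,t+1,\dots,T\}$ and the price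 process is a nonnegative adapted process $\widehat S=(\widehat S_u)_{u\in D}$ ($\widehat S_u$ is $\mathcal{F}_u$-measurable). A strategy is a family of nonnegative random variables $N=(N_{s,u})_{s,u\in D,\,s\le u}$, nonincreasing in $u\in D$ for each fixed $s$, with $N_{s,T}=0$ for all $s$, where $N_{s,u}$ is $\mathcal{F}_u$-measurable if $u\ne t-1$, whereas $N_{s,t-1}$ only has to be $\mathcal{F}_t$-measurable. The process $\eta=(\eta_u)_{u\in D}$ starts from zero initial capital and satisfies $( * )$ with $\widehat S$ in place of $S$ (and sums over $s\in D$) for $u\in D\setminus\{t+1\}$ (so $\eta_{t-1}$ is only required to be $\mathcal{F}_t$-measurable), and for $u=t+1$ the condition is replaced by $$\eta_{t+1}-\eta_{t-1}=(1-\alpha)r\,\eta_{t-1}-N_{t+1,t+1}\widehat S_{t+1}+\sum_{s=0}^{t-1}(N_{s,t-1}-N_{s,t+1})\bigl(\widehat S_{t+1}-\alpha(\widehat S_{t+1}-\widehat S_s)\bigr).$$ The liquidation value is $\eta_T$. In the special case $t=T$, one requires $N_{s,T-1}=0$ for $s=0,\dots,T-1$, the liquidation value is $\eta_{T-1}$, and the last display does not apply. $\widehat S$ satisfies (NA) in this model iff no such $(\eta,N)$ has a liquidation value that is $\ge0$ almost surely and $>0$ with positive probability. Robust local no-arbitrage. $S$ satisfies (RLNA) in period $t$ iff $P(S_{t-1}=0,S_t>0)=0$ and for every nonnegative adapted process $\widehat S=(\widehat S_u)_{u\in D}$ on $D=\{0,\dots,t-1,t+1,\dots,T\}$ the following implication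 holds: if $\widehat S$ satisfies (NA) in the model with eliminated period $t$, then the process $\widetilde S=(\widetilde S_u)_{u=0,\dots,T}$ defined by $$\widetilde S_u:=\widehat S_u\ (u\le t-1),\qquad \widetilde S_t:=\widehat S_{t-1}\frac{S_t}{S_{t-1}},\qquad \widetilde S_u:=\widehat S_u\frac{S_t}{S_{t-1}}\ (u\ge t+1),$$ with the convention $0/0:=0$, satisfies (NA) (in the original model on $\{0,\dots,T\}$, with $\widetilde S$ in place of $S$). *)

theory Defs
  imports "HOL-Probability.Probability"
begin

text \<open>
  A process is a function \<open>nat \<Rightarrow> 'a \<Rightarrow> real\<close>, of which only the values at the dates of the
  respective time domain matter. Random variables are honest functions; equations and inequalities
  between them are understood almost surely. The measures carried by the \<open>F u\<close> are irrelevant,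
  only their sigma-algebras are used. Division by zero yields zero in HOL, which subsumes the
  convention \<open>0 / 0 = 0\<close>.
\<close>

definition filtered_prob_space :: "'a measure \<Rightarrow> (nat \<Rightarrow> 'a measure) \<Rightarrow> nat \<Rightarrow> bool" where
  "filtered_prob_space M F T \<longleftrightarrow>
     prob_space M \<and> (\<forall>u\<le>T. subalgebra M (F u)) \<and> (\<forall>u v. u \<le> v \<longrightarrow> v \<le> T \<longrightarrow> subalgebra (F v) (F u))"

definition nonneg_adapted ::
    "'a measure \<Rightarrow> (nat \<Rightarrow> 'a measure) \<Rightarrow> nat set \<Rightarrow> (nat \<Rightarrow> 'a \<Rightarrow> real) \<Rightarrow> bool" where
  "nonneg_adapted M F D S \<longleftrightarrow>
     (\<forall>u\<in>D. S u \<in> borel_measurable (F u) \<and> (AE \<omega> in M. 0 \<le> S u \<omega>))"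

definition cond_probability :: "'a measure \<Rightarrow> 'a measure \<Rightarrow> ('a \<Rightarrow> bool) \<Rightarrow> 'a \<Rightarrow> real" where
  "cond_probability M G Q = real_cond_exp M G (indicat_real {\<omega> \<in> space M. Q \<omega>})"

text \<open>
  The self-financing equation for trading at date \<open>u\<close>, when \<open>p\<close> is the preceding trading date,
  \<open>x\<close> and \<open>y\<close> are the bank account after trading at \<open>p\<close> and \<open>u\<close>, and \<open>I\<close> is the set of trading
  dates before \<open>u\<close>. At the initial date, \<open>I\<close> is empty and \<open>x = 0\<close>, and \<open>p\<close> plays no role.
\<close>
definition budget_equation ::
    "'a measure \<Rightarrow> real \<Rightarrow> real \<Rightarrow> (nat \<Rightarrow> 'a \<Rightarrow> real) \<Rightarrow> (nat \<Rightarrow> nat \<Rightarrow> 'a \<Rightarrow> real) \<Rightarrow>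
     nat set \<Rightarrow> nat \<Rightarrow> nat \<Rightarrow> ('a \<Rightarrow> real) \<Rightarrow> ('a \<Rightarrow> real) \<Rightarrow> bool" where
  "budget_equation M \<alpha> r S N I p u x y \<longleftrightarrow>
     (AE \<omega> in M. y \<omega> - x \<omega> =
        (1 - \<alpha>) * r * x \<omega> - N u u \<omega> * S u \<omega>
        + (\<Sum>s\<in>I. (N s p \<omega> - N s u \<omega>) * (S u \<omega> - \<alpha> * (S u \<omega> - S s \<omega>))))"

text \<open>The bank account before trading at date \<open>u\<close>, with the convention \<open>\<eta>\<^bsub>-1\<^esub> = 0\<close>.\<close>
definition previous :: "(nat \<Rightarrow> 'a \<Rightarrow> real) \<Rightarrow> nat \<Rightarrow> 'a \<Rightarrow> real" where
  "previous \<eta> u = (if u = 0 then (\<lambda>\<omega>. 0) else \<eta> (u - 1))"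


definition stock_strategy ::
    "'a measure \<Rightarrow> (nat \<Rightarrow> 'a measure) \<Rightarrow> nat \<Rightarrow> (nat \<Rightarrow> nat \<Rightarrow> 'a \<Rightarrow> real) \<Rightarrow> bool" where
  "stock_strategy M F T N \<longleftrightarrow>
     (\<forall>s u. s \<le> u \<longrightarrow> u \<le> T \<longrightarrow>
        N s u \<in> borel_measurable (F u) \<and> (AE \<omega> in M. 0 \<le> N s u \<omega>)) \<and>
     (\<forall>s u. s \<le> u \<longrightarrow> u < T \<longrightarrow> (AE \<omega> in M. N s (Suc u) \<omega> \<le> N s u \<omega>)) \<and>
     (\<forall>s\<le>T. AE \<omega> in M. N s T \<omega> = 0)"

definition self_financing ::
    "'a measure \<Rightarrow> (nat \<Rightarrow> 'a measure) \<Rightarrow> nat \<Rightarrow> real \<Rightarrow> real \<Rightarrow> (nat \<Rightarrow> 'a \<Rightarrow> real) \<Rightarrow>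
     (nat \<Rightarrow> 'a \<Rightarrow> real) \<Rightarrow> (nat \<Rightarrow> nat \<Rightarrow> 'a \<Rightarrow> real) \<Rightarrow> bool" where
  "self_financing M F T \<alpha> r S \<eta> N \<longleftrightarrow>
     stock_strategy M F T N \<and>
     (\<forall>u\<le>T. \<eta> u \<in> borel_measurable (F u)) \<and>
     (\<forall>u\<le>T. budget_equation M \<alpha> r S N {..<u} (u - 1) u (previous \<eta> u) (\<eta> u))"

definition no_arbitrage ::
    "'a measure \<Rightarrow> (nat \<Rightarrow> 'a measure) \<Rightarrow> nat \<Rightarrow> real \<Rightarrow> real \<Rightarrow> (nat \<Rightarrow> 'a \<Rightarrow> real) \<Rightarrow> bool" where
  "no_arbitrage M F T \<alpha> r S \<longleftrightarrow>
     \<not> (\<exists>\<eta> N. self_financing M F T \<alpha> r S \<eta> N \<and>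
          (AE \<omega> in M. 0 \<le> \<eta> T \<omega>) \<and> measure M {\<omega> \<in> space M. 0 < \<eta> T \<omega>} > 0)"


text \<open>The model in which the period from \<open>t - 1\<close> to \<open>t\<close> is eliminated, for \<open>1 \<le> t \<le> T\<close>.\<close>

definition elim_dates :: "nat \<Rightarrow> nat \<Rightarrow> nat set" where
  "elim_dates T t = {..T} - {t}"

text \<open>The liquidation date; it is \<open>T - 1\<close> if the last period is eliminated.\<close>
definition elim_horizon :: "nat \<Rightarrow> nat \<Rightarrow> nat" where
  "elim_horizon T t = (if t = T then T - 1 else T)"

text \<open>Trades at \<open>t - 1\<close> may already use the information of date \<open>t\<close>.\<close>
definition elim_info :: "(nat \<Rightarrow> 'a measure) \<Rightarrow> nat \<Rightarrow> nat \<Rightarrow> 'a measure" where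
  "elim_info F t u = (if u = t - 1 then F t else F u)"

definition elim_stock_strategy ::
    "'a measure \<Rightarrow> (nat \<Rightarrow> 'a measure) \<Rightarrow> nat \<Rightarrow> nat \<Rightarrow> (nat \<Rightarrow> nat \<Rightarrow> 'a \<Rightarrow> real) \<Rightarrow> bool" where
  "elim_stock_strategy M F T t N \<longleftrightarrow>
     (\<forall>s\<in>elim_dates T t. \<forall>u\<in>elim_dates T t. s \<le> u \<longrightarrow>
        N s u \<in> borel_measurable (elim_info F t u) \<and> (AE \<omega> in M. 0 \<le> N s u \<omega>)) \<and>
     (\<forall>s\<in>elim_dates T t. \<forall>u\<in>elim_dates T t. \<forall>v\<in>elim_dates T t. s \<le> u \<longrightarrow> u \<le> v \<longrightarrow>
        (AE \<omega> in M. N s v \<omega> \<le> N s u \<omega>)) \<and>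
     (\<forall>s\<in>elim_dates T t. AE \<omega> in M. N s (elim_horizon T t) \<omega> = 0)"

definition elim_self_financing ::
    "'a measure \<Rightarrow> (nat \<Rightarrow> 'a measure) \<Rightarrow> nat \<Rightarrow> real \<Rightarrow> real \<Rightarrow> nat \<Rightarrow> (nat \<Rightarrow> 'a \<Rightarrow> real) \<Rightarrow>
     (nat \<Rightarrow> 'a \<Rightarrow> real) \<Rightarrow> (nat \<Rightarrow> nat \<Rightarrow> 'a \<Rightarrow> real) \<Rightarrow> bool" where
  "elim_self_financing M F T \<alpha> r t S \<eta> N \<longleftrightarrow>
     elim_stock_strategy M F T t N \<and>
     (\<forall>u\<in>elim_dates T t. \<eta> u \<in> borel_measurable (elim_info F t u)) \<and>
     (\<forall>u\<in>elim_dates T t - {t + 1}.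
        budget_equation M \<alpha> r S N ({..<u} \<inter> elim_dates T t) (u - 1) u (previous \<eta> u) (\<eta> u)) \<and>
     (t < T \<longrightarrow>
        budget_equation M \<alpha> r S N {..t - 1} (t - 1) (t + 1) (\<eta> (t - 1)) (\<eta> (t + 1)))"

definition elim_no_arbitrage ::
    "'a measure \<Rightarrow> (nat \<Rightarrow> 'a measure) \<Rightarrow> nat \<Rightarrow> real \<Rightarrow> real \<Rightarrow> nat \<Rightarrow> (nat \<Rightarrow> 'a \<Rightarrow> real) \<Rightarrow> bool" where
  "elim_no_arbitrage M F T \<alpha> r t S \<longleftrightarrow>
     \<not> (\<exists>\<eta> N. elim_self_financing M F T \<alpha> r t S \<eta> N \<and>
          (AE \<omega> in M. 0 \<le> \<eta> (elim_horizon T t) \<omega>) \<and>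
          measure M {\<omega> \<in> space M. 0 < \<eta> (elim_horizon T t) \<omega>} > 0)"


text \<open>Reinserting the period into a price process \<open>S'\<close> of the model with eliminated period.\<close>
definition reinserted ::
    "(nat \<Rightarrow> 'a \<Rightarrow> real) \<Rightarrow> nat \<Rightarrow> (nat \<Rightarrow> 'a \<Rightarrow> real) \<Rightarrow> nat \<Rightarrow> 'a \<Rightarrow> real" where
  "reinserted S t S' u \<omega> =
     (if u \<le> t - 1 then S' u \<omega>
      else if u = t then S' (t - 1) \<omega> * (S t \<omega> / S (t - 1) \<omega>)
      else S' u \<omega> * (S t \<omega> / S (t - 1) \<omega>))"

definition robust_local_no_arbitrage ::
    "'a measure \<Rightarrow> (nat \<Rightarrow> 'a measure) \<Rightarrow> nat \<Rightarrow> real \<Rightarrow> real \<Rightarrow> (nat \<Rightarrow> 'a \<Rightarrow> real) \<Rightarrow> nat \<Rightarrow> bool" where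
  "robust_local_no_arbitrage M F T \<alpha> r S t \<longleftrightarrow>
     measure M {\<omega> \<in> space M. S (t - 1) \<omega> = 0 \<and> 0 < S t \<omega>} = 0 \<and>
     (\<forall>S'. nonneg_adapted M F (elim_dates T t) S' \<longrightarrow>
        elim_no_arbitrage M F T \<alpha> r t S' \<longrightarrow>
        no_arbitrage M F T \<alpha> r (reinserted S t S'))"

definition kappa :: "real \<Rightarrow> real \<Rightarrow> nat \<Rightarrow> nat \<Rightarrow> real" where
  "kappa \<alpha> r t T =
     ((- \<alpha> + (1 - \<alpha>)^2 * r) * (1 + (1 - \<alpha>) * r) ^ (T - t) + \<alpha>)
       / ((1 + (1 - \<alpha>) * r) ^ (T - t) - \<alpha>)"

end

theory Submission
  imports Defs
begin

text \<open>
  Write \<open>R = 1 + (1 - \<alpha>) r\<close>, \<open>m = t - 1\<close>, \<open>x = S\<^bsub>t\<^esub> / S\<^bsub>m\<^esub>\<close>. Given an arbitrage \<open>N\<close> for the reinserted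
  prices, the investor without the period knows \<open>x\<close> when trading at \<open>m\<close>, and has three ways to
  imitate \<open>N\<close>. (H) Keep \<open>x/R\<close> of every share: after division by \<open>R\<close> this dominates \<open>N\<close> if \<open>x \<le> R\<close>.
  (L) Liquidate everything at \<open>m\<close> and rebuy \<open>x/R\<close> times the shares that \<open>N\<close> holds: this loses the
  deferral of taxes, yet dominates \<open>N\<close> if \<open>x - 1 < \<kappa>\<close>, with a gain proportional to the market value
  \<open>W\<close> of the shares that \<open>N\<close> holds at \<open>m\<close>; it also dominates \<open>N\<close> if \<open>W = 0\<close>, whatever \<open>x\<close>. (C) Cash out
  for the liquidation value \<open>V\<close>.

  Where \<open>x - 1 < \<kappa>\<close> and \<open>V \<le> 0\<close>, strategy (L) entered at \<open>m\<close> with zero wealth yields at least \<open>- V\<close>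
  plus the gain, so no-arbitrage forces \<open>V = W = 0\<close> there. As \<open>V\<close> and \<open>W\<close> are known at \<open>m\<close>, the
  conditional probability hypothesis turns this into: \<open>V > 0\<close> or \<open>V = W = 0\<close>, wherever \<open>x > R\<close>. Playing (H)
  where \<open>x \<le> R\<close>, (C) where \<open>x > R\<close> and \<open>V > 0\<close>, and (L) elsewhere is then an arbitrage.
\<close>

section \<open>Wealth generated by single share lots\<close>

text \<open>
  The wealth at date \<open>k\<close> generated by the shares bought at \<open>s\<close>, of which \<open>n u\<close> are held after trading
  at \<open>u\<close>. Shares still held after \<open>k\<close> count as worthless.
\<close>
definition lot :: "real \<Rightarrow> real \<Rightarrow> (nat \<Rightarrow> real) \<Rightarrow> nat \<Rightarrow> (nat \<Rightarrow> real) \<Rightarrow> nat \<Rightarrow> real" where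
  "lot \<alpha> R S k n s =
     (\<Sum>u\<in>{s<..k}. R ^ (k - u) * ((n (u - 1) - n u) * (S u - \<alpha> * (S u - S s))))
     - R ^ (k - s) * (n s * S s)"

text \<open>The bank account splits over lots because the tax on a sale involves only the purchase
  price of the lot that is sold.\<close>

definition account :: "real \<Rightarrow> real \<Rightarrow> (nat \<Rightarrow> real) \<Rightarrow> (nat \<Rightarrow> nat \<Rightarrow> real) \<Rightarrow> nat \<Rightarrow> real" where
  "account \<alpha> R S N k = (\<Sum>s\<le>k. lot \<alpha> R S k (N s) s)"

lemma lot_self: "lot \<alpha> R S s n s = - (n s * S s)"
  by (simp add: lot_def)

lemma lot_Suc:
  assumes "s \<le> k"
  shows "lot \<alpha> R S (Suc k) n s =
    R * lot \<alpha> R S k n s + (n k - n (Suc k)) * (S (Suc k) - \<alpha> * (S (Suc k) - S s))"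
proof -
  have "{s<..Suc k} = insert (Suc k) {s<..k}"
    using assms by auto
  moreover have "(\<Sum>u\<in>{s<..k}. R ^ (Suc k - u) * ((n (u - 1) - n u) * (S u - \<alpha> * (S u - S s)))) =
      R * (\<Sum>u\<in>{s<..k}. R ^ (k - u) * ((n (u - 1) - n u) * (S u - \<alpha> * (S u - S s))))"
    unfolding sum_distrib_left by (intro sum.cong) (auto simp: Suc_diff_le)
  ultimately show ?thesis
    using assms by (simp add: lot_def Suc_diff_le right_diff_distrib)
qed

lemma lot_cong:
  assumes "\<And>u. s \<le> u \<Longrightarrow> u \<le> k \<Longrightarrow> n u = n' u"
    and "\<And>u. s \<le> u \<Longrightarrow> u \<le> k \<Longrightarrow> S u = S' u" and "s \<le> k"
  shows "lot \<alpha> R S k n s = lot \<alpha> R S' k n' s"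
proof -
  have "R ^ (k - u) * ((n (u - 1) - n u) * (S u - \<alpha> * (S u - S s))) =
      R ^ (k - u) * ((n' (u - 1) - n' u) * (S' u - \<alpha> * (S' u - S' s)))" if "u \<in> {s<..k}" for u
  proof -
    have "n (u - 1) = n' (u - 1)" "n u = n' u" "S u = S' u" "S s = S' s"
      using that by (auto intro!: assms)
    then show ?thesis by simp
  qed
  then have "(\<Sum>u\<in>{s<..k}. R ^ (k - u) * ((n (u - 1) - n u) * (S u - \<alpha> * (S u - S s)))) =
      (\<Sum>u\<in>{s<..k}. R ^ (k - u) * ((n' (u - 1) - n' u) * (S' u - \<alpha> * (S' u - S' s))))"
    by (rule sum.cong[OF refl])
  moreover have "n s = n' s" "S s = S' s"
    using assms by auto
  ultimately show ?thesis
    by (simp add: lot_def)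
qed

lemma lot_add: "lot \<alpha> R S k (\<lambda>u. n u + n' u) s = lot \<alpha> R S k n s + lot \<alpha> R S k n' s"
  by (simp add: lot_def sum.distrib[symmetric] algebra_simps)

lemma lot_scale: "lot \<alpha> R S k (\<lambda>u. c * n u) s = c * lot \<alpha> R S k n s"
  by (simp add: lot_def sum_distrib_left algebra_simps)

lemma lot_sum:
  "finite A \<Longrightarrow> lot \<alpha> R S k (\<lambda>u. \<Sum>i\<in>A. n i u) s = (\<Sum>i\<in>A. lot \<alpha> R S k (n i) s)"
proof (induction A rule: finite_induct)
  case empty
  then show ?case by (simp add: lot_def)
next
  case (insert i A)
  then show ?case by (simp add: lot_add)
qed

lemma account_0: "account \<alpha> R S N 0 = - (N 0 0 * S 0)"
  by (simp add: account_def lot_self)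

text \<open>With \<open>R = 1 + (1 - \<alpha>) * r\<close> this is the self-financing equation,
  which determines the bank account recursively.\<close>

lemma account_Suc:
  "account \<alpha> R S N (Suc k) = R * account \<alpha> R S N k - N (Suc k) (Suc k) * S (Suc k) +
     (\<Sum>s\<le>k. (N s k - N s (Suc k)) * (S (Suc k) - \<alpha> * (S (Suc k) - S s)))"
  by (simp add: account_def lot_self lot_Suc sum.distrib sum_distrib_left)

text \<open>\<open>P\<close> lists the prices of the model without the period, numbered
  consecutively; hence the shift \<open>k - 1\<close>. The value \<open>x * P m\<close> at
  \<open>Suc m\<close> is the price at the end of the reinserted period.\<close>

definition reinserted_path :: "nat \<Rightarrow> real \<Rightarrow> (nat \<Rightarrow> real) \<Rightarrow> nat \<Rightarrow> real" where
  "reinserted_path m x P k = (if k \<le> m then P k else x * P (k - 1))"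

text \<open>Models full liquidation of a lot at \<open>m\<close>: for a lot bought earlier, the drop
  to zero books the sale of \<open>n (m - 1)\<close> shares at that date.\<close>

definition held_before :: "nat \<Rightarrow> (nat \<Rightarrow> real) \<Rightarrow> nat \<Rightarrow> real" where
  "held_before m n k = (if k < m then n k else 0)"

text \<open>Lots bought after the period see prices that are merely delayed and multiplied by
  \<open>R * y\<close>. A factor on all prices acts like the same factor on all share numbers:
  \<open>y\<close> moves into the shares, \<open>R\<close> stays outside.\<close>

lemma lot_reinserted_late:
  assumes "m \<le> s" "s \<le> k"
  shows "lot \<alpha> R (reinserted_path m (R * y) P) (Suc k) n (Suc s) =
    R * lot \<alpha> R P k (\<lambda>u. y * n (Suc u)) s"
  using assms(2)
proof (induction k rule: dec_induct)
  case base
  show ?case using assms(1) by (simp add: lot_self reinserted_path_def)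
next
  case (step k)
  have "lot \<alpha> R (reinserted_path m (R * y) P) (Suc (Suc k)) n (Suc s) =
      R * lot \<alpha> R (reinserted_path m (R * y) P) (Suc k) n (Suc s)
      + (n (Suc k) - n (Suc (Suc k))) * (R * y * P (Suc k) - \<alpha> * (R * y * P (Suc k) - R * y * P s))"
    using step assms by (simp add: lot_Suc[of "Suc s" "Suc k"]) (simp add: reinserted_path_def)
  then show ?case
    using step by (simp add: lot_Suc algebra_simps)
qed

text \<open>Compounded value of one unit of cash per share sold after \<open>Suc m\<close>, in the
  numbering with the period. A change of tax base alters the proceeds of all these sales by the same
  amount per share, so it enters the comparisons through this factor.\<close>

definition residual :: "real \<Rightarrow> (nat \<Rightarrow> real) \<Rightarrow> nat \<Rightarrow> nat \<Rightarrow> real" where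
  "residual R n m k = (\<Sum>u\<in>{m<..k}. R ^ (k - u) * (n u - n (Suc u)))"

lemma residual_Suc:
  assumes "m \<le> k"
  shows "residual R n m (Suc k) = R * residual R n m k + (n (Suc k) - n (Suc (Suc k)))"
proof -
  have "{m<..Suc k} = insert (Suc k) {m<..k}"
    using assms by auto
  moreover have "(\<Sum>u\<in>{m<..k}. R ^ (Suc k - u) * (n u - n (Suc u))) =
      R * (\<Sum>u\<in>{m<..k}. R ^ (k - u) * (n u - n (Suc u)))"
    unfolding sum_distrib_left by (intro sum.cong) (auto simp: Suc_diff_le)
  ultimately show ?thesis
    using assms by (simp add: residual_def)
qed

text \<open>The numbers of shares sold telescope to \<open>n (Suc m) - n (Suc k)\<close>, and each
  sale is compounded by a factor between 1 and \<open>R ^ (k - m)\<close>.\<close>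

lemma residual_bounds:
  assumes "m \<le> k" "1 \<le> R" "\<And>u. m < u \<Longrightarrow> u \<le> k \<Longrightarrow> n (Suc u) \<le> n u"
  shows "n (Suc m) - n (Suc k) \<le> residual R n m k"
    and "residual R n m k \<le> R ^ (k - m) * (n (Suc m) - n (Suc k))"
    and "n (Suc k) \<le> n (Suc m)"
proof -
  have "n (Suc k) \<le> n (Suc m) \<and> n (Suc m) - n (Suc k) \<le> residual R n m k \<and>
    residual R n m k \<le> R ^ (k - m) * (n (Suc m) - n (Suc k))"
    using assms(1,3)
  proof (induction k rule: dec_induct)
    case base
    then show ?case by (simp add: residual_def)
  next
    case (step k)
    have d: "n (Suc (Suc k)) \<le> n (Suc k)"
      using step by simp
    have IH: "n (Suc k) \<le> n (Suc m)" "n (Suc m) - n (Suc k) \<le> residual R n m k"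
      "residual R n m k \<le> R ^ (k - m) * (n (Suc m) - n (Suc k))"
      using step by auto
    have "1 * residual R n m k \<le> R * residual R n m k"
      using IH assms(2) by (intro mult_right_mono) auto
    moreover have "R * residual R n m k \<le> R * (R ^ (k - m) * (n (Suc m) - n (Suc k)))"
      using IH assms(2) by (intro mult_left_mono) auto
    moreover have "1 * (n (Suc k) - n (Suc (Suc k))) \<le> R ^ (Suc k - m) * (n (Suc k) - n (Suc (Suc k)))"
      using d assms(2) by (intro mult_right_mono one_le_power) auto
    ultimately show ?case
      using d IH step.hyps by (auto simp: residual_Suc Suc_diff_le algebra_simps)
  qed
  then show "n (Suc m) - n (Suc k) \<le> residual R n m k"
    and "residual R n m k \<le> R ^ (k - m) * (n (Suc m) - n (Suc k))"
    and "n (Suc k) \<le> n (Suc m)"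
    by auto
qed

section \<open>Exact comparison for a lot bought up to date \<open>m\<close>\<close>

lemma lot_held_before_base:
  assumes "s \<le> m"
  shows "lot \<alpha> R P m (held_before m n) s =
    lot \<alpha> R P m n s + n m * (P m - \<alpha> * (P m - P s))"
proof (cases "s = m")
  case True
  then show ?thesis by (simp add: lot_self held_before_def)
next
  case False
  then obtain m' where m: "m = Suc m'" "s \<le> m'"
    using assms by (metis le_neq_implies_less less_Suc_eq_le not0_implies_Suc not_less_zero)
  have "lot \<alpha> R P m' (held_before m n) s = lot \<alpha> R P m' n s"
    using m by (intro lot_cong) (auto simp: held_before_def)
  then show ?thesis
    using m by (simp add: lot_Suc held_before_def algebra_simps)
qed

lemma lot_reinserted_base:
  assumes "s \<le> m"
  shows "lot \<alpha> R (reinserted_path m x P) (Suc m) n s = R * lot \<alpha> R P m n s +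
    (n m - n (Suc m)) * (x * P m - \<alpha> * (x * P m - P s))"
proof -
  have "lot \<alpha> R (reinserted_path m x P) m n s = lot \<alpha> R P m n s"
    using assms by (intro lot_cong) (auto simp: reinserted_path_def)
  then show ?thesis
    using assms by (simp add: lot_Suc) (simp add: reinserted_path_def)
qed

text \<open>After the period the market values of the sales agree, since \<open>R\<close> times
  \<open>y\<close> shares at price \<open>P\<close> is one share at \<open>R * y * P\<close>. What
  differs is the cash from trading at the period, compounded by \<open>R ^ (k - m)\<close>, and the
  tax base per share sold later, \<open>R * y * P m\<close> instead of \<open>P s\<close>.\<close>

lemma lot_rebuy_eq:
  assumes "s \<le> m" "m \<le> k"
  shows "R * (lot \<alpha> R P k (held_before m n) s + lot \<alpha> R P k (\<lambda>u. y * n (Suc u)) m) =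
    lot \<alpha> R (reinserted_path m (R * y) P) (Suc k) n s +
    R ^ (k - m) * (R * n m * (P m - \<alpha> * (P m - P s)) - R * y * n (Suc m) * P m
      - (n m - n (Suc m)) * (R * y * P m - \<alpha> * (R * y * P m - P s)))
    + residual R n m k * (\<alpha> * R * y * P m - \<alpha> * P s)"
  using assms(2)
proof (induction k rule: dec_induct)
  case base
  show ?case
    using assms(1) by (simp add: lot_held_before_base lot_reinserted_base lot_self residual_def algebra_simps)
next
  case (step k)
  define A where "A = lot \<alpha> R P k (held_before m n) s"
  define B where "B = lot \<alpha> R P k (\<lambda>u. y * n (Suc u)) m"
  define C where "C = lot \<alpha> R (reinserted_path m (R * y) P) (Suc k) n s"
  have 0: "lot \<alpha> R P (Suc k) (held_before m n) s = R * A"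
    using step assms unfolding A_def by (simp add: lot_Suc held_before_def)
  have 1: "lot \<alpha> R P (Suc k) (\<lambda>u. y * n (Suc u)) m = R * B
      + y * (n (Suc k) - n (Suc (Suc k))) * (P (Suc k) - \<alpha> * (P (Suc k) - P m))"
    using step unfolding B_def by (simp add: lot_Suc algebra_simps)
  have 2: "lot \<alpha> R (reinserted_path m (R * y) P) (Suc (Suc k)) n s = R * C
      + (n (Suc k) - n (Suc (Suc k))) * (R * y * P (Suc k) - \<alpha> * (R * y * P (Suc k) - P s))"
    using step assms unfolding C_def by (simp add: lot_Suc[of s "Suc k"]) (simp add: reinserted_path_def)
  have 3: "R ^ (Suc k - m) = R * R ^ (k - m)"
    using step by (simp add: Suc_diff_le)
  have 4: "residual R n m (Suc k) = R * residual R n m k + (n (Suc k) - n (Suc (Suc k)))"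
    using step by (simp add: residual_Suc)
  define D where "D = R ^ (k - m) * (R * n m * (P m - \<alpha> * (P m - P s)) - R * y * n (Suc m) * P m
      - (n m - n (Suc m)) * (R * y * P m - \<alpha> * (R * y * P m - P s)))"
  have 5: "C = R * (A + B) - D - residual R n m k * (\<alpha> * (R * y) * P m - \<alpha> * P s)"
    using step.IH unfolding A_def B_def C_def D_def by (simp add: mult.assoc)
  show ?case
    unfolding 0 1 2 3 4 5 D_def by (simp add: algebra_simps)
qed

text \<open>As for rebuying, except that the shares kept retain their purchase price, so the tax
  base is \<open>R * y * P s\<close> instead of \<open>P s\<close>.\<close>

lemma lot_hold_eq:
  assumes "s \<le> m" "m \<le> k"
  shows "R * lot \<alpha> R P k (\<lambda>u. if u < m then n u else y * n (Suc u)) s =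
    lot \<alpha> R (reinserted_path m (R * y) P) (Suc k) n s +
    R ^ (k - m) * ((R * n m - R * y * n (Suc m)) * (P m - \<alpha> * (P m - P s))
      - (n m - n (Suc m)) * (R * y * P m - \<alpha> * (R * y * P m - P s)))
    + residual R n m k * (\<alpha> * (R * y - 1) * P s)"
  using assms(2)
proof (induction k rule: dec_induct)
  case base
  have "lot \<alpha> R P m (\<lambda>u. if u < m then n u else y * n (Suc u)) s =
    lot \<alpha> R P m (\<lambda>u. held_before m n u + (if u < m then 0 else y * n (Suc u))) s"
    by (intro lot_cong) (auto simp: held_before_def assms)
  also have "\<dots> = lot \<alpha> R P m (held_before m n) s + lot \<alpha> R P m (\<lambda>u. if u < m then 0 else y * n (Suc u)) s"
    by (rule lot_add)
  also have "lot \<alpha> R P m (\<lambda>u. if u < m then 0 else y * n (Suc u)) s =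
     - (y * n (Suc m) * (P m - \<alpha> * (P m - P s)))"
  proof -
    \<comment> \<open>\<open>lot_held_before_base\<close> is used backwards on holdings that vanish
      before \<open>m\<close>: their truncation is zero, so only the trade at \<open>m\<close> is
      left.\<close>
    have "lot \<alpha> R P m (held_before m (\<lambda>u. if u < m then 0 else y * n (Suc u))) s = lot \<alpha> R P m (\<lambda>u. 0 * n u) s"
      by (intro lot_cong) (auto simp: held_before_def assms)
    then show ?thesis
      using lot_held_before_base[OF assms(1), of \<alpha> R P "\<lambda>u. if u < m then 0 else y * n (Suc u)"]
      unfolding lot_scale by simp
  qed
  finally have hold: "lot \<alpha> R P m (\<lambda>u. if u < m then n u else y * n (Suc u)) s =
      lot \<alpha> R P m (held_before m n) s + - (y * n (Suc m) * (P m - \<alpha> * (P m - P s)))" .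
  show ?case
    unfolding hold lot_held_before_base[OF assms(1)] lot_reinserted_base[OF assms(1)]
    by (simp add: residual_def algebra_simps)
next
  case (step k)
  define A where "A = lot \<alpha> R P k (\<lambda>u. if u < m then n u else y * n (Suc u)) s"
  define C where "C = lot \<alpha> R (reinserted_path m (R * y) P) (Suc k) n s"
  have 1: "lot \<alpha> R P (Suc k) (\<lambda>u. if u < m then n u else y * n (Suc u)) s = R * A
      + y * (n (Suc k) - n (Suc (Suc k))) * (P (Suc k) - \<alpha> * (P (Suc k) - P s))"
    using step assms(1) unfolding A_def by (simp add: lot_Suc algebra_simps)
  have 2: "lot \<alpha> R (reinserted_path m (R * y) P) (Suc (Suc k)) n s = R * C
      + (n (Suc k) - n (Suc (Suc k))) * (R * y * P (Suc k) - \<alpha> * (R * y * P (Suc k) - P s))"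
    using step assms unfolding C_def by (simp add: lot_Suc[of s "Suc k"]) (simp add: reinserted_path_def)
  have 3: "R ^ (Suc k - m) = R * R ^ (k - m)"
    using step by (simp add: Suc_diff_le)
  have 4: "residual R n m (Suc k) = R * residual R n m k + (n (Suc k) - n (Suc (Suc k)))"
    using step by (simp add: residual_Suc)
  define D where "D = R ^ (k - m) * ((R * n m - R * y * n (Suc m)) * (P m - \<alpha> * (P m - P s))
      - (n m - n (Suc m)) * (R * y * P m - \<alpha> * (R * y * P m - P s)))"
  have 5: "C = R * A - D - residual R n m k * (\<alpha> * (R * y - 1) * P s)"
    using step.IH unfolding A_def C_def D_def by linarith
  show ?case
    unfolding 1 2 3 4 5 D_def by (simp add: algebra_simps)
qed


text \<open>The surplus in \<open>lot_hold_eq\<close> splits into a part with factor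
  \<open>P m\<close>, nonnegative because \<open>y \<le> 1\<close>, and a tax part with factor
  \<open>P s\<close>, whose sign follows from the bounds on \<open>residual\<close>.\<close>

lemma lot_hold_ge:
  assumes sm: "s \<le> m" "m \<le> k" and R: "1 \<le> R" and y: "0 \<le> y" "y \<le> 1"
    and \<alpha>: "0 \<le> \<alpha>" "\<alpha> < 1" and P: "0 \<le> P m" "0 \<le> P s"
    and n: "\<And>u. m \<le> u \<Longrightarrow> u \<le> k \<Longrightarrow> n (Suc u) \<le> n u" "n (Suc k) = 0"
  shows "lot \<alpha> R (reinserted_path m (R * y) P) (Suc k) n s
    \<le> R * lot \<alpha> R P k (\<lambda>u. if u < m then n u else y * n (Suc u)) s"
proof -
  define q where "q = R ^ (k - m)"
  define \<Sigma> where "\<Sigma> = residual R n m k"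
  have q: "0 \<le> q" using R by (simp add: q_def)
  have bds: "n (Suc m) \<le> \<Sigma>" "\<Sigma> \<le> q * n (Suc m)"
    using residual_bounds[of m k R n] assms by (auto simp: q_def \<Sigma>_def)
  have nm: "n (Suc m) \<le> n m" "0 \<le> n (Suc m)"
    using n(1)[of m] sm residual_bounds(3)[of m k R n] assms by auto
  \<comment> \<open>\<open>R * y - 1\<close> is the return over the period. If it is nonnegative,
    both summands are; otherwise the second is negative at worst, and the upper bound on
    \<open>\<Sigma>\<close> lets the first absorb it.\<close>
  have "0 \<le> q * (R * n m - R * y * n (Suc m) - n m + n (Suc m)) + (R * y - 1) * \<Sigma>"
  proof (cases "1 \<le> R * y")
    case True
    have "(R * y - 1) * n (Suc m) \<le> (R * y - 1) * n m"
      using True nm by (intro mult_left_mono) auto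
    moreover have "R * y * n m \<le> R * n m"
      using mult_left_mono[OF y(2), of R] R nm by (intro mult_right_mono) auto
    ultimately have "0 \<le> q * (R * n m - R * y * n (Suc m) - n m + n (Suc m))"
      using q by (intro mult_nonneg_nonneg) (auto simp: algebra_simps)
    moreover have "0 \<le> (R * y - 1) * \<Sigma>"
      using True bds nm by (intro mult_nonneg_nonneg) auto
    ultimately show ?thesis by linarith
  next
    case False
    then have "(R * y - 1) * (q * n (Suc m)) \<le> (R * y - 1) * \<Sigma>"
      using bds by (intro mult_left_mono_neg) auto
    moreover have "0 \<le> q * ((R - 1) * n m)"
      using q R nm by (intro mult_nonneg_nonneg) auto
    ultimately show ?thesis by (simp add: algebra_simps)
  qed
  then have "0 \<le> \<alpha> * P s * (q * (R * n m - R * y * n (Suc m) - n m + n (Suc m)) + (R * y - 1) * \<Sigma>)"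
    using \<alpha> P by simp
  moreover have "0 \<le> (1 - \<alpha>) * P m * (q * (R * (1 - y) * n m))"
    using \<alpha> P q R y nm by (intro mult_nonneg_nonneg) auto
  moreover have "q * ((R * n m - R * y * n (Suc m)) * (P m - \<alpha> * (P m - P s))
      - (n m - n (Suc m)) * (R * y * P m - \<alpha> * (R * y * P m - P s))) + \<Sigma> * (\<alpha> * (R * y - 1) * P s)
    = \<alpha> * P s * (q * (R * n m - R * y * n (Suc m) - n m + n (Suc m)) + (R * y - 1) * \<Sigma>)
      + (1 - \<alpha>) * P m * (q * (R * (1 - y) * n m))"
    by (simp add: algebra_simps)
  ultimately show ?thesis
    using lot_hold_eq[OF sm, of R \<alpha> P n y] unfolding q_def \<Sigma>_def by linarith
qed

text \<open>The surplus in \<open>lot_rebuy_eq\<close> is the stated multiple of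
  \<open>n m * P m\<close> plus three nonnegative terms. These vanish for a lot with
  \<open>P s = 0\<close> that is kept unchanged from \<open>m\<close> until its sale at
  \<open>Suc k\<close>; this worst case, where tax deferral is longest, fixes the constant.\<close>

lemma lot_rebuy_ge:
  assumes sm: "s \<le> m" "m \<le> k" and R: "1 \<le> R" and y: "0 \<le> y"
    and \<alpha>: "0 \<le> \<alpha>" "\<alpha> < 1" and P: "0 \<le> P m" "0 \<le> P s"
    and n: "\<And>u. m \<le> u \<Longrightarrow> u \<le> k \<Longrightarrow> n (Suc u) \<le> n u" "n (Suc k) = 0"
  shows "lot \<alpha> R (reinserted_path m (R * y) P) (Suc k) n s
      + R * ((1 - \<alpha>) * R ^ (k - m) - y * (R ^ (k - m) - \<alpha>)) * (n m * P m)
    \<le> R * (lot \<alpha> R P k (held_before m n) s + lot \<alpha> R P k (\<lambda>u. y * n (Suc u)) m)"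
proof -
  define q where "q = R ^ (k - m)"
  define \<Sigma> where "\<Sigma> = residual R n m k"
  have q: "1 \<le> q" using R by (simp add: q_def)
  have bds: "n (Suc m) \<le> \<Sigma>" "\<Sigma> \<le> q * n (Suc m)"
    using residual_bounds[of m k R n] assms by (auto simp: q_def \<Sigma>_def)
  have nm: "n (Suc m) \<le> n m" "0 \<le> n (Suc m)"
    using n(1)[of m] sm residual_bounds(3)[of m k R n] assms by auto
  have "0 \<le> q * ((R - 1) * n m)"
    using q R nm by (intro mult_nonneg_nonneg) auto
  then have "0 \<le> \<alpha> * P s * (q * (R * n m - n m + n (Suc m)) - \<Sigma>)"
    using \<alpha> P bds by (intro mult_nonneg_nonneg) (auto simp: algebra_simps)
  moreover have "0 \<le> \<alpha> * (R * y) * P m * (\<Sigma> - n (Suc m))"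
    using \<alpha> P y R bds by (intro mult_nonneg_nonneg) auto
  moreover have "0 \<le> \<alpha> * (R * y) * P m * ((q - 1) * (n m - n (Suc m)))"
    using \<alpha> P y R q nm by (intro mult_nonneg_nonneg) auto
  moreover have "q * (R * n m * (P m - \<alpha> * (P m - P s)) - R * y * n (Suc m) * P m
      - (n m - n (Suc m)) * (R * y * P m - \<alpha> * (R * y * P m - P s)))
      + \<Sigma> * (\<alpha> * (R * y) * P m - \<alpha> * P s)
    = R * ((1 - \<alpha>) * q - y * (q - \<alpha>)) * (n m * P m)
      + \<alpha> * P s * (q * (R * n m - n m + n (Suc m)) - \<Sigma>)
      + \<alpha> * (R * y) * P m * (\<Sigma> - n (Suc m))
      + \<alpha> * (R * y) * P m * ((q - 1) * (n m - n (Suc m)))"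
    by (simp add: algebra_simps)
  ultimately show ?thesis
    using lot_rebuy_eq[OF sm, of R \<alpha> P n y] unfolding q_def \<Sigma>_def by (simp add: mult.assoc)
qed


section \<open>Trading without the period\<close>

text \<open>
  Dates from \<open>m + 1\<close> on are renumbered by \<open>u \<mapsto> u - 1\<close>, so that date \<open>m\<close> stands for both ends of the
  eliminated period. The weights \<open>c\<close>, \<open>h\<close>, \<open>l\<close> are 0 or 1: \<open>c\<close> tells whether \<open>N\<close> is followed before
  \<open>m\<close>, \<open>h\<close> selects keeping the fraction \<open>y\<close> of the shares, \<open>l\<close> selects liquidation followed by a purchase
  of \<open>y\<close> times the shares (\<open>y > 1\<close> is possible here), and \<open>h = l = 0\<close> cashing out.
\<close>
definition merged :: "nat \<Rightarrow> real \<Rightarrow> real \<Rightarrow> real \<Rightarrow> real \<Rightarrow> (nat \<Rightarrow> nat \<Rightarrow> real) \<Rightarrow> nat \<Rightarrow> nat \<Rightarrow> real" where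
  "merged m y c h l N j k =
     (if k < m then c * N j k
      else if j < m then h * (y * N j (Suc k))
      else (h + l) * (y * N (Suc j) (Suc k)) +
        (if j = m then h * (y * N m (Suc k)) + l * (\<Sum>s\<le>m. y * N s (Suc k)) else 0))"

text \<open>The liquidation value \<open>V\<close> of the overview, compounded to date
  \<open>k\<close>. The lot of date \<open>m\<close> is left out, as buying and selling at the same
  price yields nothing.\<close>

definition cash_out :: "real \<Rightarrow> real \<Rightarrow> nat \<Rightarrow> (nat \<Rightarrow> real) \<Rightarrow> (nat \<Rightarrow> nat \<Rightarrow> real) \<Rightarrow> nat \<Rightarrow> real" where
  "cash_out \<alpha> R m P N k = (\<Sum>s<m. lot \<alpha> R P k (held_before m (N s)) s)"

text \<open>Strategy conditions in a single scenario, so that the dominance estimates can be proved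
  path by path.\<close>

definition liquidated_strategy :: "nat \<Rightarrow> (nat \<Rightarrow> nat \<Rightarrow> real) \<Rightarrow> bool" where
  "liquidated_strategy T N \<longleftrightarrow>
     (\<forall>s u. s \<le> u \<longrightarrow> u \<le> T \<longrightarrow> 0 \<le> N s u) \<and>
     (\<forall>s u. s \<le> u \<longrightarrow> u < T \<longrightarrow> N s (Suc u) \<le> N s u) \<and>
     (\<forall>s\<le>T. N s T = 0)"

text \<open>For \<open>j \<ge> m\<close>, lot \<open>Suc j\<close> of \<open>N\<close> becomes lot
  \<open>j\<close>. As date \<open>m\<close> stands for both ends of the period, its lot also takes
  over what \<open>N\<close> bought at \<open>m\<close> when holding, or all rebought shares when
  liquidating.\<close>

lemma account_merged:
  assumes "m \<le> k"
  shows "account \<alpha> R P (merged m y c h l N) k =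
    (\<Sum>j<m. lot \<alpha> R P k (\<lambda>u. if u < m then c * N j u else h * (y * N j (Suc u))) j) +
    (h + l) * (\<Sum>j=m..k. lot \<alpha> R P k (\<lambda>u. y * N (Suc j) (Suc u)) j) +
    h * lot \<alpha> R P k (\<lambda>u. y * N m (Suc u)) m +
    l * (\<Sum>s\<le>m. lot \<alpha> R P k (\<lambda>u. y * N s (Suc u)) m)"
proof -
  define A where "A = h * lot \<alpha> R P k (\<lambda>u. y * N m (Suc u)) m +
      l * (\<Sum>s\<le>m. lot \<alpha> R P k (\<lambda>u. y * N s (Suc u)) m)"
  have "lot \<alpha> R P k (merged m y c h l N j) j =
      lot \<alpha> R P k (\<lambda>u. if u < m then c * N j u else h * (y * N j (Suc u))) j" if "j < m" for j
    using that assms by (intro lot_cong) (auto simp: merged_def)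
  moreover have "lot \<alpha> R P k (merged m y c h l N j) j =
      (h + l) * lot \<alpha> R P k (\<lambda>u. y * N (Suc j) (Suc u)) j + (if j = m then A else 0)"
    if "m \<le> j" "j \<le> k" for j
  proof -
    have "lot \<alpha> R P k (merged m y c h l N j) j =
      lot \<alpha> R P k (\<lambda>u. (h + l) * (y * N (Suc j) (Suc u)) +
        (if j = m then h * (y * N m (Suc u)) + l * (\<Sum>s\<le>m. y * N s (Suc u)) else 0)) j"
      using that by (intro lot_cong) (auto simp: merged_def)
    also have "\<dots> = (h + l) * lot \<alpha> R P k (\<lambda>u. y * N (Suc j) (Suc u)) j + (if j = m then A else 0)"
    proof (cases "j = m")
      case True
      then show ?thesis
        unfolding True
        by (simp only: simp_thms if_True lot_add lot_scale[of _ _ _ _ "h + l"] lot_scale[of _ _ _ _ h]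
            lot_scale[of _ _ _ _ l] lot_sum[OF finite_atMost] A_def)
    next
      case False
      then show ?thesis by (simp add: lot_scale[of _ _ _ _ "h + l"])
    qed
    finally show ?thesis .
  qed
  moreover have "account \<alpha> R P (merged m y c h l N) k =
      (\<Sum>j<m. lot \<alpha> R P k (merged m y c h l N j) j) + (\<Sum>j=m..k. lot \<alpha> R P k (merged m y c h l N j) j)"
  proof -
    have "{..k} = {..<m} \<union> {m..k}" using assms by auto
    then show ?thesis by (simp add: account_def sum.union_disjoint ivl_disj_int)
  qed
  ultimately show ?thesis
    using assms by (simp add: sum.distrib sum_distrib_left A_def)
qed

text \<open>Lots bought after the period carry over exactly, so only those bought up to
  \<open>m\<close> need estimates.\<close>

lemma account_reinserted:
  assumes "m \<le> k"
  shows "account \<alpha> R (reinserted_path m (R * y) P) N (Suc k) =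
    (\<Sum>s\<le>m. lot \<alpha> R (reinserted_path m (R * y) P) (Suc k) (N s) s) +
    R * (\<Sum>j=m..k. lot \<alpha> R P k (\<lambda>u. y * N (Suc j) (Suc u)) j)"
proof -
  have "{..Suc k} = {..m} \<union> {Suc m..Suc k}" using assms by auto
  then have "account \<alpha> R (reinserted_path m (R * y) P) N (Suc k) =
    (\<Sum>s\<le>m. lot \<alpha> R (reinserted_path m (R * y) P) (Suc k) (N s) s) +
    (\<Sum>s=Suc m..Suc k. lot \<alpha> R (reinserted_path m (R * y) P) (Suc k) (N s) s)"
    by (simp add: account_def sum.union_disjoint ivl_disj_int del: atMost_Suc)
  also have "(\<Sum>s=Suc m..Suc k. lot \<alpha> R (reinserted_path m (R * y) P) (Suc k) (N s) s) =
      (\<Sum>j=m..k. R * lot \<alpha> R P k (\<lambda>u. y * N (Suc j) (Suc u)) j)"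
    unfolding sum.shift_bounds_cl_Suc_ivl by (intro sum.cong) (auto simp: lot_reinserted_late)
  finally show ?thesis by (simp add: sum_distrib_left)
qed

lemma account_hold:
  assumes m: "m \<le> k" and R: "1 \<le> R" and y: "0 \<le> y" "y \<le> 1"
    and \<alpha>: "0 \<le> \<alpha>" "\<alpha> < 1" and P: "\<And>u. u \<le> k \<Longrightarrow> 0 \<le> P u"
    and N: "liquidated_strategy (Suc k) N"
  shows "account \<alpha> R (reinserted_path m (R * y) P) N (Suc k) \<le>
    R * account \<alpha> R P (merged m y 1 1 0 N) k"
proof -
  define H where "H = (\<lambda>s. lot \<alpha> R P k (\<lambda>u. if u < m then N s u else y * N s (Suc u)) s)"
  have "lot \<alpha> R (reinserted_path m (R * y) P) (Suc k) (N s) s \<le> R * H s" if "s \<le> m" for s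
    unfolding H_def using assms that by (intro lot_hold_ge) (auto simp: liquidated_strategy_def)
  then have "(\<Sum>s\<le>m. lot \<alpha> R (reinserted_path m (R * y) P) (Suc k) (N s) s) \<le> R * (\<Sum>s\<le>m. H s)"
    unfolding sum_distrib_left by (intro sum_mono) auto
  moreover have "(\<Sum>s\<le>m. H s) = (\<Sum>s<m. H s) + lot \<alpha> R P k (\<lambda>u. y * N m (Suc u)) m"
  proof -
    have "lot \<alpha> R P k (\<lambda>u. y * N m (Suc u)) m = H m"
      unfolding H_def using m by (intro lot_cong) auto
    then show ?thesis by (simp flip: lessThan_Suc_atMost)
  qed
  ultimately show ?thesis
    unfolding account_merged[OF m] account_reinserted[OF m] by (simp add: H_def algebra_simps)
qed

text \<open>For \<open>c = 0\<close> the trades before \<open>m\<close> are omitted and the purchase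
  at \<open>m\<close> is made without prior wealth; the last term adds back what these trades would
  have yielded.\<close>

lemma account_rebuy:
  assumes m: "m \<le> k" and R: "1 \<le> R" and y: "0 \<le> y"
    and \<alpha>: "0 \<le> \<alpha>" "\<alpha> < 1" and P: "\<And>u. u \<le> k \<Longrightarrow> 0 \<le> P u"
    and N: "liquidated_strategy (Suc k) N"
  shows "account \<alpha> R (reinserted_path m (R * y) P) N (Suc k)
      + R * ((1 - \<alpha>) * R ^ (k - m) - y * (R ^ (k - m) - \<alpha>)) * (\<Sum>s\<le>m. N s m * P m)
    \<le> R * (account \<alpha> R P (merged m y c 0 1 N) k + (1 - c) * cash_out \<alpha> R m P N k)"
proof -
  define K where "K = (1 - \<alpha>) * R ^ (k - m) - y * (R ^ (k - m) - \<alpha>)"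
  have "(\<Sum>s\<le>m. lot \<alpha> R (reinserted_path m (R * y) P) (Suc k) (N s) s + R * K * (N s m * P m)) \<le>
    (\<Sum>s\<le>m. R * (lot \<alpha> R P k (held_before m (N s)) s + lot \<alpha> R P k (\<lambda>u. y * N s (Suc u)) m))"
    unfolding K_def using assms by (intro sum_mono lot_rebuy_ge) (auto simp: liquidated_strategy_def)
  moreover have "(\<Sum>s\<le>m. lot \<alpha> R P k (held_before m (N s)) s) = cash_out \<alpha> R m P N k"
  proof -
    have "lot \<alpha> R P k (held_before m (N m)) m = lot \<alpha> R P k (\<lambda>u. 0 * N m u) m"
      using m by (intro lot_cong) (auto simp: held_before_def)
    then have "lot \<alpha> R P k (held_before m (N m)) m = 0"
      unfolding lot_scale by simp
    then show ?thesis by (simp add: cash_out_def flip: lessThan_Suc_atMost)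
  qed
  moreover have "(\<Sum>j<m. lot \<alpha> R P k (\<lambda>u. if u < m then c * N j u else 0) j) = c * cash_out \<alpha> R m P N k"
  proof -
    have "(\<lambda>u. if u < m then c * N j u else 0) = (\<lambda>u. c * held_before m (N j) u)" for j
      by (auto simp: held_before_def)
    then show ?thesis by (simp add: lot_scale cash_out_def sum_distrib_left)
  qed
  ultimately show ?thesis
    unfolding account_merged[OF m] account_reinserted[OF m] K_def[symmetric]
    by (simp add: sum.distrib sum_distrib_left[symmetric] algebra_simps)
qed

lemma account_cash_out:
  assumes "m \<le> k"
  shows "account \<alpha> R P (merged m y c 0 0 N) k = c * cash_out \<alpha> R m P N k"
proof -
  have "(\<lambda>u. if u < m then c * N j u else 0 * (y * N j (Suc u))) = (\<lambda>u. c * held_before m (N j) u)" for j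
    by (auto simp: held_before_def)
  then show ?thesis
    using account_merged[OF assms, of \<alpha> R P y c 0 0 N] by (simp add: lot_scale cash_out_def sum_distrib_left)
qed

text \<open>The critical point is the passage from \<open>m - 1\<close> to \<open>m\<close>, where
  the fraction of a lot that is kept must not exceed the previous holding; hence
  \<open>h \<le> c\<close> and \<open>h * y \<le> h\<close>. Rebought shares form a new lot at
  \<open>m\<close>, so \<open>l\<close> puts no upper bound on \<open>y\<close>.\<close>

lemma liquidated_strategy_merged:
  assumes "m \<le> k" "0 \<le> y" "0 \<le> h" "h \<le> c" "0 \<le> l" "h * y \<le> h"
    and N: "liquidated_strategy (Suc k) N"
  shows "liquidated_strategy k (merged m y c h l N)"
proof -
  have nn: "0 \<le> N s u" if "s \<le> u" "u \<le> Suc k" for s u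
    using N that by (auto simp: liquidated_strategy_def)
  have dec: "N s (Suc u) \<le> N s u" if "s \<le> u" "u \<le> k" for s u
    using N that by (auto simp: liquidated_strategy_def)
  have zero: "N s (Suc k) = 0" if "s \<le> Suc k" for s
    using N that by (auto simp: liquidated_strategy_def)
  have "0 \<le> merged m y c h l N s u" if "s \<le> u" "u \<le> k" for s u
    unfolding merged_def using that assms
    by (auto intro!: mult_nonneg_nonneg add_nonneg_nonneg sum_nonneg nn)
  moreover have "merged m y c h l N s (Suc u) \<le> merged m y c h l N s u" if "s \<le> u" "u < k" for s u
  proof -
    consider "Suc u < m" | "Suc u = m" | "m \<le> u" by linarith
    then show ?thesis
    proof cases
      case 1
      then show ?thesis
        unfolding merged_def using that assms by (auto intro!: mult_left_mono dec)
    next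
      case 2
      have "h * y * N s (Suc m) \<le> h * N s (Suc m)"
        using assms nn[of s "Suc m"] that 2 by (intro mult_right_mono) auto
      also have "\<dots> \<le> c * N s u"
        using assms nn[of s "Suc m"] dec[of s m] dec[of s u] that 2 by (intro mult_mono) auto
      finally show ?thesis
        unfolding merged_def using that 2 by (auto simp: mult.assoc)
    next
      case 3
      then show ?thesis
        unfolding merged_def using that assms
        by (auto intro!: mult_left_mono add_mono sum_mono dec)
    qed
  qed
  moreover have "merged m y c h l N s k = 0" if "s \<le> k" for s
    unfolding merged_def using that assms zero by simp
  ultimately show ?thesis
    by (auto simp: liquidated_strategy_def)
qed

section \<open>Strategies in the two models\<close>

text \<open>After \<open>m\<close> only interest accrues. Thus the liquidation value, although
  stated at \<open>k\<close>, is already known at \<open>m\<close>.\<close>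

lemma lot_held_before_late:
  assumes "s \<le> m" "m \<le> k"
  shows "lot \<alpha> R P k (held_before m n) s = R ^ (k - m) * lot \<alpha> R P m (held_before m n) s"
  using assms(2)
proof (induction k rule: dec_induct)
  case (step k)
  then show ?case
    using assms(1) by (simp add: lot_Suc held_before_def Suc_diff_le)
qed simp

section \<open>Measurability of lots, accounts and merged strategies\<close>

lemma borel_measurable_lot:
  assumes "\<And>u. s \<le> u \<Longrightarrow> u \<le> k \<Longrightarrow> (\<lambda>\<omega>. S \<omega> u) \<in> borel_measurable G"
    and "\<And>u. s \<le> u \<Longrightarrow> u \<le> k \<Longrightarrow> (\<lambda>\<omega>. n \<omega> u) \<in> borel_measurable G"
    and "s \<le> k"
  shows "(\<lambda>\<omega>. lot \<alpha> R (S \<omega>) k (n \<omega>) s) \<in> borel_measurable G"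
  unfolding lot_def
  by (intro borel_measurable_diff borel_measurable_times borel_measurable_sum borel_measurable_const
      assms) (auto simp: assms(3))

lemma borel_measurable_account:
  assumes "\<And>u. u \<le> k \<Longrightarrow> (\<lambda>\<omega>. S \<omega> u) \<in> borel_measurable G"
    and "\<And>s u. s \<le> u \<Longrightarrow> u \<le> k \<Longrightarrow> (\<lambda>\<omega>. N \<omega> s u) \<in> borel_measurable G"
  shows "(\<lambda>\<omega>. account \<alpha> R (S \<omega>) (N \<omega>) k) \<in> borel_measurable G"
  unfolding account_def by (intro borel_measurable_sum borel_measurable_lot assms) auto

lemma borel_measurable_filtration_mono:
  assumes "filtered_prob_space M F T" "f \<in> borel_measurable (F u)" "u \<le> v" "v \<le> T"
  shows "f \<in> borel_measurable (F v)"
proof -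
  have "subalgebra (F v) (F u)"
    using assms(1,3,4) unfolding filtered_prob_space_def by blast
  then show ?thesis using assms(2) by (rule measurable_from_subalg)
qed

lemma borel_measurable_filtration:
  assumes "filtered_prob_space M F T" "f \<in> borel_measurable (F u)" "u \<le> T"
  shows "f \<in> borel_measurable M"
proof -
  have "subalgebra M (F u)"
    using assms(1,3) unfolding filtered_prob_space_def by blast
  then show ?thesis using assms(2) by (rule measurable_from_subalg)
qed

text \<open>From \<open>m\<close> on, the consecutive number \<open>u\<close> carries the
  information of \<open>Suc u\<close>. At \<open>u = m\<close> this is what lets \<open>y\<close>,
  \<open>h\<close> and \<open>l\<close> depend on the price at the end of the period.\<close>

lemma borel_measurable_merged:
  assumes filt: "filtered_prob_space M F (Suc k)"
    and N: "\<And>s u. s \<le> u \<Longrightarrow> u \<le> Suc k \<Longrightarrow> N s u \<in> borel_measurable (F u)"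
    and y: "y \<in> borel_measurable (F (Suc m))" and h: "h \<in> borel_measurable (F (Suc m))"
    and l: "l \<in> borel_measurable (F (Suc m))" and "s \<le> u" "u \<le> k"
  shows "(\<lambda>\<omega>. merged m (y \<omega>) c (h \<omega>) (l \<omega>) (\<lambda>s u. N s u \<omega>) s u)
    \<in> borel_measurable (F (if u < m then u else Suc u))"
proof (cases "u < m")
  case True
  then have "(\<lambda>\<omega>. c * N s u \<omega>) \<in> borel_measurable (F u)"
    using assms by (intro borel_measurable_times borel_measurable_const N) auto
  then show ?thesis using True by (simp add: merged_def)
next
  case False
  have yhl: "y \<in> borel_measurable (F (Suc u))" "h \<in> borel_measurable (F (Suc u))"
    "l \<in> borel_measurable (F (Suc u))"
    using False assms(7)
    by (auto intro!: borel_measurable_filtration_mono[OF filt y] borel_measurable_filtration_mono[OF filt h]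
        borel_measurable_filtration_mono[OF filt l])
  have "N j (Suc u) \<in> borel_measurable (F (Suc u))" if "j \<le> Suc u" for j
    using N that assms by auto
  then show ?thesis
    using False assms(6) yhl unfolding merged_def
    by (cases "s < m"; cases "s = m")
      (auto intro!: borel_measurable_add borel_measurable_times borel_measurable_sum)
qed

section \<open>Consecutive numbering of the remaining dates, and the budget equations\<close>

definition skip :: "nat \<Rightarrow> nat \<Rightarrow> nat" where
  "skip m u = (if u \<le> m then u else Suc u)"

lemma self_financing_account:
  assumes "self_financing M F T \<alpha> r S \<eta> N" "u \<le> T"
  shows "AE \<omega> in M. \<eta> u \<omega> = account \<alpha> (1 + (1 - \<alpha>) * r) (\<lambda>v. S v \<omega>) (\<lambda>s v. N s v \<omega>) u"
  using assms(2)
proof (induction u)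
  case 0
  have "budget_equation M \<alpha> r S N {..<0} (0 - 1) 0 (previous \<eta> 0) (\<eta> 0)"
    using assms(1) unfolding self_financing_def by blast
  then show ?case
    by (simp add: budget_equation_def previous_def account_0)
next
  case (Suc u)
  have "budget_equation M \<alpha> r S N {..<Suc u} (Suc u - 1) (Suc u) (previous \<eta> (Suc u)) (\<eta> (Suc u))"
    using assms(1) Suc.prems unfolding self_financing_def by blast
  moreover have "AE \<omega> in M. \<eta> u \<omega> = account \<alpha> (1 + (1 - \<alpha>) * r) (\<lambda>v. S v \<omega>) (\<lambda>s v. N s v \<omega>) u"
    using Suc by simp
  ultimately show ?case
    unfolding budget_equation_def previous_def lessThan_Suc_atMost
    by eventually_elim (simp add: account_Suc algebra_simps)
qed

lemma stock_strategy_liquidated: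
  assumes "stock_strategy M F T N"
  shows "AE \<omega> in M. liquidated_strategy T (\<lambda>s u. N s u \<omega>)"
proof -
  have "AE \<omega> in M. \<forall>s u. s \<le> u \<longrightarrow> u \<le> T \<longrightarrow> 0 \<le> N s u \<omega>"
    unfolding AE_all_countable using assms by (auto simp: stock_strategy_def)
  moreover have "AE \<omega> in M. \<forall>s u. s \<le> u \<longrightarrow> u < T \<longrightarrow> N s (Suc u) \<omega> \<le> N s u \<omega>"
    unfolding AE_all_countable using assms by (auto simp: stock_strategy_def)
  moreover have "AE \<omega> in M. \<forall>s. s \<le> T \<longrightarrow> N s T \<omega> = 0"
    unfolding AE_all_countable using assms by (auto simp: stock_strategy_def)
  ultimately show ?thesis
    by eventually_elim (auto simp: liquidated_strategy_def)
qed

lemma liquidated_strategy_antimono: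
  assumes "liquidated_strategy T N" "s \<le> u" "u \<le> v" "v \<le> T"
  shows "N s v \<le> N s u"
  using assms(3,4)
proof (induction v rule: dec_induct)
  case (step v)
  have "N s (Suc v) \<le> N s v"
    using assms(1,2) step by (auto simp: liquidated_strategy_def)
  then show ?case using step by simp
qed simp

text \<open>Makes no-arbitrage without the period applicable to strategies in consecutive numbering:
  dates are translated back and the bank account is defined as \<open>account\<close>, so that only
  admissibility has to be checked.\<close>

lemma elim_no_arbitrage_account:
  assumes filt: "filtered_prob_space M F (Suc k)" and m: "m \<le> k"
    and S: "nonneg_adapted M F (elim_dates (Suc k) (Suc m)) S"
    and NA: "elim_no_arbitrage M F (Suc k) \<alpha> r (Suc m) S"
    and meas: "\<And>s u. s \<le> u \<Longrightarrow> u \<le> k \<Longrightarrow>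
      (\<lambda>\<omega>. N \<omega> s u) \<in> borel_measurable (F (if u < m then u else Suc u))"
    and N: "AE \<omega> in M. liquidated_strategy k (N \<omega>)"
    and nn: "AE \<omega> in M. 0 \<le> account \<alpha> (1 + (1 - \<alpha>) * r) (\<lambda>u. S (skip m u) \<omega>) (N \<omega>) k"
  shows "AE \<omega> in M. account \<alpha> (1 + (1 - \<alpha>) * r) (\<lambda>u. S (skip m u) \<omega>) (N \<omega>) k = 0"
proof -
  define R where "R = 1 + (1 - \<alpha>) * r"
  define C where "C = (\<lambda>u. if u \<le> m then u else u - 1)"
  define P where "P = (\<lambda>\<omega> u. S (skip m u) \<omega>)"
  define N' where "N' = (\<lambda>s u \<omega>. N \<omega> (C s) (C u))"
  define \<eta> where "\<eta> = (\<lambda>u \<omega>. account \<alpha> R (P \<omega>) (N \<omega>) (C u))"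
  let ?D = "elim_dates (Suc k) (Suc m)"
  have D: "?D = {..Suc k} - {Suc m}" by (simp add: elim_dates_def)
  have C_skip: "C (skip m u) = u" for u
    by (auto simp: C_def skip_def)
  have C_le: "C u \<le> k" if "u \<in> ?D" for u
    using that m by (auto simp: C_def D)
  have C_mono: "C u \<le> C v" if "u \<le> v" for u v
    using that by (auto simp: C_def)
  \<comment> \<open>If the last period is eliminated, then \<open>k = m\<close> and the liquidation
    date is \<open>k\<close> itself; otherwise it is \<open>Suc k\<close>. Both have number
    \<open>k\<close>.\<close>
  have C_hor: "C (elim_horizon (Suc k) (Suc m)) = k"
    using m by (auto simp: C_def elim_horizon_def)
  have info: "F (if C u < m then C u else Suc (C u)) = elim_info F (Suc m) u" if "u \<in> ?D" for u
    using that m by (auto simp: C_def D elim_info_def)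
  have P_meas: "(\<lambda>\<omega>. P \<omega> v) \<in> borel_measurable (F (if u < m then u else Suc u))"
    if "v \<le> u" "u \<le> k" for u v
  proof -
    have "S (skip m v) \<in> borel_measurable (F (skip m v))"
      using S that m by (auto simp: nonneg_adapted_def D skip_def)
    moreover have "skip m v \<le> (if u < m then u else Suc u)" "(if u < m then u else Suc u) \<le> Suc k"
      using that by (auto simp: skip_def)
    ultimately show ?thesis
      unfolding P_def by (rule borel_measurable_filtration_mono[OF filt])
  qed
  have N_meas: "(\<lambda>\<omega>. N \<omega> s v) \<in> borel_measurable (F (if u < m then u else Suc u))"
    if "s \<le> v" "v \<le> u" "u \<le> k" for s u v
    using that by (intro borel_measurable_filtration_mono[OF filt meas[of s v]]) auto
  have strat: "elim_stock_strategy M F (Suc k) (Suc m) N'"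
    unfolding elim_stock_strategy_def
  proof (intro conjI ballI impI)
    fix s u assume su: "s \<in> ?D" "u \<in> ?D" "s \<le> u"
    then show "N' s u \<in> borel_measurable (elim_info F (Suc m) u)"
      unfolding N'_def info[OF su(2), symmetric] by (intro meas C_mono C_le)
    show "AE \<omega> in M. 0 \<le> N' s u \<omega>"
      using C_mono[OF su(3)] C_le[OF su(2)]
      unfolding N'_def by (intro eventually_mono[OF N]) (auto simp: liquidated_strategy_def)
    fix v assume v: "v \<in> ?D" "u \<le> v"
    show "AE \<omega> in M. N' s v \<omega> \<le> N' s u \<omega>"
      using C_mono[OF su(3)] C_mono[OF v(2)] C_le[OF v(1)]
      unfolding N'_def by (intro eventually_mono[OF N] liquidated_strategy_antimono)
  next
    fix s assume "s \<in> ?D"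
    then show "AE \<omega> in M. N' s (elim_horizon (Suc k) (Suc m)) \<omega> = 0"
      using C_le unfolding N'_def C_hor
      by (intro eventually_mono[OF N]) (auto simp: liquidated_strategy_def)
  qed
  have \<eta>_meas: "\<eta> u \<in> borel_measurable (elim_info F (Suc m) u)" if "u \<in> ?D" for u
    unfolding \<eta>_def info[OF that, symmetric]
    by (rule borel_measurable_account[OF P_meas[of _ "C u"] N_meas[of _ _ "C u"]]) (use C_le that in auto)
  \<comment> \<open>One recursion covers all later budget equations: \<open>w = m\<close> gives the
    modified one that bridges the gap, every other \<open>w\<close> an ordinary one.\<close>
  have budget: "budget_equation M \<alpha> r S N' (skip m ` {..w}) (skip m w) (skip m (Suc w))
      (\<eta> (skip m w)) (\<eta> (skip m (Suc w)))" for w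
  proof -
    have "inj_on (skip m) {..w}"
      by (auto simp: inj_on_def skip_def split: if_splits)
    then show ?thesis
      by (simp add: budget_equation_def \<eta>_def N'_def C_skip sum.reindex account_Suc R_def P_def
          algebra_simps)
  qed
  have "budget_equation M \<alpha> r S N' ({..<u} \<inter> ?D) (u - 1) u (previous \<eta> u) (\<eta> u)"
    if u: "u \<in> ?D - {Suc m + 1}" for u
  proof -
    consider "u = 0" | w where "u = Suc w" "w < m" | w where "u = Suc (Suc w)" "m < w" "w < k"
    proof (cases u)
      case 0
      then show thesis using that by blast
    next
      case (Suc v)
      show thesis
      proof (cases "v < m")
        case True
        then show thesis using that Suc by blast
      next
        case False
        then have "Suc m < v"
          using u Suc by (auto simp: D)
        moreover from this obtain w where "v = Suc w"
          by (cases v) auto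
        ultimately show thesis using that(3)[of w] u Suc by (auto simp: D)
      qed
    qed
    then show ?thesis
    proof cases
      case 1
      then show ?thesis
        by (simp add: budget_equation_def previous_def \<eta>_def C_def account_0 N'_def P_def skip_def)
    next
      case 2
      have "{..<u} \<inter> ?D = skip m ` {..w}"
        using 2 m by (auto simp: skip_def D image_def)
      then show ?thesis
        using budget[of w] 2 by (simp add: skip_def previous_def)
    next
      case 3
      have "{..<u} \<inter> ?D = skip m ` {..w}"
      proof (intro equalityI subsetI)
        fix j assume "j \<in> {..<u} \<inter> ?D"
        then have "j = skip m (C j)" "C j \<le> w"
          using 3 by (auto simp: skip_def C_def D)
        then show "j \<in> skip m ` {..w}" by blast
      qed (use 3 in \<open>auto simp: skip_def D\<close>)
      then show ?thesis
        using budget[of w] 3 by (simp add: skip_def previous_def)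
    qed
  qed
  moreover have "budget_equation M \<alpha> r S N' {..Suc m - 1} (Suc m - 1) (Suc m + 1) (\<eta> (Suc m - 1)) (\<eta> (Suc m + 1))"
  proof -
    have "skip m ` {..m} = {..m}" by (auto simp: skip_def image_def)
    then show ?thesis using budget[of m] by (simp add: skip_def)
  qed
  ultimately have "elim_self_financing M F (Suc k) \<alpha> r (Suc m) S \<eta> N'"
    unfolding elim_self_financing_def using strat \<eta>_meas by blast
  moreover have hor: "\<eta> (elim_horizon (Suc k) (Suc m)) \<omega> = account \<alpha> R (P \<omega>) (N \<omega>) k" for \<omega>
    unfolding \<eta>_def C_hor ..
  moreover have "AE \<omega> in M. 0 \<le> \<eta> (elim_horizon (Suc k) (Suc m)) \<omega>"
    using nn unfolding hor R_def P_def .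
  ultimately have "\<not> measure M {\<omega> \<in> space M. 0 < \<eta> (elim_horizon (Suc k) (Suc m)) \<omega>} > 0"
    using NA unfolding elim_no_arbitrage_def by blast
  then have "measure M {\<omega> \<in> space M. 0 < account \<alpha> R (P \<omega>) (N \<omega>) k} = 0"
    using measure_nonneg[of M "{\<omega> \<in> space M. 0 < account \<alpha> R (P \<omega>) (N \<omega>) k}"]
    unfolding hor by linarith
  moreover have "(\<lambda>\<omega>. account \<alpha> R (P \<omega>) (N \<omega>) k) \<in> borel_measurable M"
    by (rule borel_measurable_filtration[OF filt
          borel_measurable_account[OF P_meas[of _ k] N_meas[of _ _ k]]]) auto
  moreover have "finite_measure M"
    using filt by (simp add: filtered_prob_space_def prob_space_def)
  ultimately have "AE \<omega> in M. \<not> 0 < account \<alpha> R (P \<omega>) (N \<omega>) k"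
    by (subst AE_iff_measurable[OF _ refl]) (simp_all add: finite_measure.emeasure_eq_measure)
  then show ?thesis
    using nn unfolding R_def P_def by eventually_elim simp
qed

section \<open>Conditional probabilities\<close>

lemma integral_cond_probability:
  assumes "prob_space M" "subalgebra M G" "A \<in> sets G" "Measurable.pred M Q"
  shows "integrable M (\<lambda>\<omega>. indicat_real A \<omega> * cond_probability M G Q \<omega>)"
    and "(\<integral>\<omega>. indicat_real A \<omega> * cond_probability M G Q \<omega> \<partial>M) = measure M (A \<inter> {\<omega> \<in> space M. Q \<omega>})"
proof -
  interpret prob_space M by fact
  interpret finite_measure_subalgebra M G
    by unfold_locales fact
  have A: "A \<in> sets M"
    using assms by (auto simp: subalgebra_def)
  have [measurable]: "{\<omega> \<in> space M. Q \<omega>} \<in> sets M"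
    using assms by simp
  have int: "integrable M (\<lambda>\<omega>. indicat_real A \<omega> * indicat_real {\<omega> \<in> space M. Q \<omega>} \<omega>)"
    using A by (simp flip: indicator_inter_arith add: less_top[symmetric])
  have "(\<integral>\<omega>. indicat_real A \<omega> * cond_probability M G Q \<omega> \<partial>M) =
     (\<integral>\<omega>. indicat_real A \<omega> * indicat_real {\<omega> \<in> space M. Q \<omega>} \<omega> \<partial>M)"
    unfolding cond_probability_def using assms(3) int by (intro real_cond_exp_intg(2)) auto
  also have "\<dots> = measure M (A \<inter> {\<omega> \<in> space M. Q \<omega>})"
    using A by (simp flip: indicator_inter_arith)
  finally show "(\<integral>\<omega>. indicat_real A \<omega> * cond_probability M G Q \<omega> \<partial>M) = measure M (A \<inter> {\<omega> \<in> space M. Q \<omega>})" .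
  show "integrable M (\<lambda>\<omega>. indicat_real A \<omega> * cond_probability M G Q \<omega>)"
    unfolding cond_probability_def using assms(3) int by (intro real_cond_exp_intg(1)) auto
qed

text \<open>The conditional probability is nonnegative, and its integral over \<open>A\<close> is
  the probability of a null event.\<close>

lemma cond_probability_eq_0:
  assumes "prob_space M" "subalgebra M G" "A \<in> sets G" "Measurable.pred M Q"
    and "AE \<omega> in M. \<omega> \<in> A \<longrightarrow> \<not> Q \<omega>"
  shows "AE \<omega> in M. \<omega> \<in> A \<longrightarrow> cond_probability M G Q \<omega> = 0"
proof -
  interpret prob_space M by fact
  interpret finite_measure_subalgebra M G
    by unfold_locales fact
  have A: "A \<in> sets M"
    using assms by (auto simp: subalgebra_def)
  have "AE \<omega> in M. 0 \<le> cond_probability M G Q \<omega>"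
    unfolding cond_probability_def using assms(4) by (intro real_cond_exp_pos) auto
  moreover have "measure M (A \<inter> {\<omega> \<in> space M. Q \<omega>}) = 0"
  proof -
    have "AE \<omega> in M. \<omega> \<notin> A \<inter> {\<omega> \<in> space M. Q \<omega>}"
      using assms(5) by eventually_elim auto
    then show ?thesis
      using A assms(4) by (subst (asm) AE_iff_null_sets[symmetric]) (auto simp: measure_eq_0_null_sets)
  qed
  ultimately have "AE \<omega> in M. indicat_real A \<omega> * cond_probability M G Q \<omega> = 0"
    using integral_cond_probability[OF assms(1-4)]
    by (subst integral_nonneg_eq_0_iff_AE[symmetric]) (auto elim!: eventually_mono)
  then show ?thesis
    by eventually_elim auto
qed

text \<open>Integration over \<open>A\<close> shows that \<open>A\<close> and its part where
  \<open>Q\<close> holds have equal measure.\<close>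

lemma cond_probability_eq_1:
  assumes "prob_space M" "subalgebra M G" "A \<in> sets G" "Measurable.pred M Q"
    and "AE \<omega> in M. \<omega> \<in> A \<longrightarrow> cond_probability M G Q \<omega> = 1"
  shows "AE \<omega> in M. \<omega> \<in> A \<longrightarrow> Q \<omega>"
proof -
  interpret prob_space M by fact
  have A: "A \<in> sets M"
    using assms by (auto simp: subalgebra_def)
  have "measure M (A \<inter> {\<omega> \<in> space M. Q \<omega>}) = (\<integral>\<omega>. indicat_real A \<omega> * cond_probability M G Q \<omega> \<partial>M)"
    using integral_cond_probability[OF assms(1-4)] by simp
  also have "\<dots> = (\<integral>\<omega>. indicat_real A \<omega> \<partial>M)"
    using assms(5) A borel_measurable_integrable[OF integral_cond_probability(1)[OF assms(1-4)]]
    by (intro integral_cong_AE) (auto elim!: eventually_mono simp: indicator_def)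
  also have "\<dots> = measure M A"
    using A by simp
  finally have "measure M (A - A \<inter> {\<omega> \<in> space M. Q \<omega>}) = 0"
    using A assms(4) by (subst finite_measure_Diff) auto
  then have "AE \<omega> in M. \<omega> \<notin> A - A \<inter> {\<omega> \<in> space M. Q \<omega>}"
    using A assms(4) by (intro AE_not_in) (auto simp: null_sets_def emeasure_eq_measure)
  then show ?thesis
    by (rule AE_mp) (auto intro!: AE_I2)
qed

section \<open>Robust local no-arbitrage\<close>

text \<open>\<open>kappa\<close> is the return at which the constant of \<open>lot_rebuy_ge\<close>
  changes sign: with \<open>q = R ^ (k - m)\<close>, \<open>1 + kappa\<close> equals
  \<open>(1 - \<alpha>) * q * R / (q - \<alpha>)\<close>.\<close>

lemma rebuy_profit:
  assumes "0 \<le> \<alpha>" "\<alpha> < 1" "0 < r" "0 < b"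
    and "(a - b) / b < kappa \<alpha> r (Suc m) (Suc k)"
  shows "0 < (1 - \<alpha>) * (1 + (1 - \<alpha>) * r) ^ (k - m)
    - a / b / (1 + (1 - \<alpha>) * r) * ((1 + (1 - \<alpha>) * r) ^ (k - m) - \<alpha>)"
proof -
  define R where "R = 1 + (1 - \<alpha>) * r"
  define q where "q = R ^ (k - m)"
  define x where "x = a / b"
  have R: "1 < R" using assms by (simp add: R_def)
  then have q: "0 < q - \<alpha>"
    using one_le_power[of R "k - m"] assms(2) \<open>\<alpha> < 1\<close> unfolding q_def by linarith
  have "x - 1 < ((- \<alpha> + (1 - \<alpha>)^2 * r) * q + \<alpha>) / (q - \<alpha>)"
    using assms(4,5) by (simp add: x_def q_def R_def kappa_def diff_divide_distrib)
  then have "(x - 1) * (q - \<alpha>) < (- \<alpha> + (1 - \<alpha>)^2 * r) * q + \<alpha>"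
    using q by (simp add: pos_less_divide_eq)
  then have "x * (q - \<alpha>) < (1 - \<alpha>) * q * R"
    by (simp add: R_def algebra_simps power2_eq_square)
  then have "x * (q - \<alpha>) / R < (1 - \<alpha>) * q"
    using R by (simp add: pos_divide_less_eq)
  then show ?thesis
    by (simp add: x_def q_def R_def)
qed

theorem theorem2p12:
  fixes M :: "'a measure" and F :: "nat \<Rightarrow> 'a measure" and T t :: nat
    and \<alpha> r :: real and S :: "nat \<Rightarrow> 'a \<Rightarrow> real"
  assumes "filtered_prob_space M F T"
    and "0 \<le> \<alpha>" and "\<alpha> < 1" and "0 < r"
    and "nonneg_adapted M F {..T} S"
    and "1 \<le> t" and "t \<le> T"
    and "measure M {\<omega> \<in> space M. S (t - 1) \<omega> = 0 \<and> 0 < S t \<omega>} = 0"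
    and "AE \<omega> in M.
           cond_probability M (F (t - 1))
             (\<lambda>\<omega>'. (S t \<omega>' - S (t - 1) \<omega>') / S (t - 1) \<omega>' < kappa \<alpha> r t T) \<omega> > 0 \<or>
           cond_probability M (F (t - 1))
             (\<lambda>\<omega>'. (S t \<omega>' - S (t - 1) \<omega>') / S (t - 1) \<omega>' \<le> (1 - \<alpha>) * r) \<omega> = 1"
  shows "robust_local_no_arbitrage M F T \<alpha> r S t"
proof -
  obtain k m where T: "T = Suc k" and t: "t = Suc m" and m: "m \<le> k"
    using assms(6,7) by (metis One_nat_def Suc_le_D Suc_le_mono le_trans)
  note filt = assms(1)[unfolded T]
  interpret prob_space M
    using filt by (simp add: filtered_prob_space_def)
  define R where "R = 1 + (1 - \<alpha>) * r"
  have R: "1 < R" using assms(2-4) by (simp add: R_def)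
  define x where "x = (\<lambda>\<omega>. S (Suc m) \<omega> / S m \<omega>)"
  define y where "y = (\<lambda>\<omega>. x \<omega> / R)"
  have Ry: "R * y \<omega> = x \<omega>" for \<omega>
    using R by (simp add: y_def)
  have y_le: "y \<omega> \<le> 1 \<longleftrightarrow> x \<omega> \<le> R" for \<omega>
    using R by (simp add: y_def)
  have S_meas: "S m \<in> borel_measurable (F m)" "S m \<in> borel_measurable (F (Suc m))"
      "S (Suc m) \<in> borel_measurable (F (Suc m))"
    using assms(5) m by (auto simp: nonneg_adapted_def T
        intro: borel_measurable_filtration_mono[OF filt, of "S m" m "Suc m"])
  have S_nn: "AE \<omega> in M. 0 \<le> S m \<omega>" "AE \<omega> in M. 0 \<le> S (Suc m) \<omega>"
    using assms(5) m by (auto simp: nonneg_adapted_def T)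
  have y_meas: "y \<in> borel_measurable (F (Suc m))" and x_meas: "x \<in> borel_measurable (F (Suc m))"
    unfolding y_def x_def using S_meas by measurable
  define return where "return = (\<lambda>\<omega>. (S (Suc m) \<omega> - S m \<omega>) / S m \<omega>)"
  have return_meas: "return \<in> borel_measurable (F (Suc m))" "return \<in> borel_measurable M"
  proof -
    show *: "return \<in> borel_measurable (F (Suc m))"
      unfolding return_def using S_meas by measurable
    show "return \<in> borel_measurable M"
      using borel_measurable_filtration[OF filt *] m by simp
  qed
  have "no_arbitrage M F T \<alpha> r (reinserted S t S')"
    if adapted: "nonneg_adapted M F (elim_dates (Suc k) (Suc m)) S'"
      and NA: "elim_no_arbitrage M F (Suc k) \<alpha> r (Suc m) S'" for S'
    unfolding no_arbitrage_def T t
  proof (intro notI, elim exE conjE)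
    fix \<eta> N
    assume sf: "self_financing M F (Suc k) \<alpha> r (reinserted S (Suc m) S') \<eta> N"
      and \<eta>_nn: "AE \<omega> in M. 0 \<le> \<eta> (Suc k) \<omega>"
      and \<eta>_pos: "0 < measure M {\<omega> \<in> space M. 0 < \<eta> (Suc k) \<omega>}"
    define P where "P = (\<lambda>\<omega> u. S' (skip m u) \<omega>)"
    define N' where "N' = (\<lambda>\<omega> s u. N s u \<omega>)"
    define V where "V = (\<lambda>\<omega>. cash_out \<alpha> R m (P \<omega>) (N' \<omega>) k)"
    define W where "W = (\<lambda>\<omega>. \<Sum>s\<le>m. N' \<omega> s m * P \<omega> m)"
    define A where "A = (\<lambda>\<omega>. account \<alpha> R (reinserted_path m (R * y \<omega>) (P \<omega>)) (N' \<omega>) (Suc k))"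
    have path: "(\<lambda>u. reinserted S (Suc m) S' u \<omega>) = reinserted_path m (R * y \<omega>) (P \<omega>)" for \<omega>
      by (auto simp: fun_eq_iff reinserted_def reinserted_path_def Ry x_def P_def skip_def)
    have strat: "stock_strategy M F (Suc k) N"
      using sf by (simp add: self_financing_def)
    have N_meas: "N s u \<in> borel_measurable (F u)" if "s \<le> u" "u \<le> Suc k" for s u
      using strat that by (auto simp: stock_strategy_def)
    have A: "AE \<omega> in M. A \<omega> = \<eta> (Suc k) \<omega>"
      using self_financing_account[OF sf order_refl]
      by eventually_elim (simp add: A_def path R_def N'_def)
    have N_valid: "AE \<omega> in M. liquidated_strategy (Suc k) (N' \<omega>)"
      using stock_strategy_liquidated[OF strat] by (simp add: N'_def)
    have P_nn: "AE \<omega> in M. \<forall>u. u \<le> k \<longrightarrow> 0 \<le> P \<omega> u"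
      unfolding AE_all_countable P_def using adapted
      by (auto simp: nonneg_adapted_def elim_dates_def skip_def)
    have P_meas: "(\<lambda>\<omega>. P \<omega> u) \<in> borel_measurable (F m)" if "u \<le> m" for u
    proof -
      have "S' u \<in> borel_measurable (F u)"
        using adapted that m by (auto simp: nonneg_adapted_def elim_dates_def)
      then have "S' u \<in> borel_measurable (F m)"
        by (rule borel_measurable_filtration_mono[OF filt]) (use that m in auto)
      then show ?thesis using that by (simp add: P_def skip_def)
    qed
    have N'_meas: "(\<lambda>\<omega>. N' \<omega> s u) \<in> borel_measurable (F m)" if "s \<le> u" "u \<le> m" for s u
      unfolding N'_def
      by (rule borel_measurable_filtration_mono[OF filt N_meas[of s u]]) (use that m in auto)
    have V_meas: "V \<in> borel_measurable (F m)"
    proof -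
      have "V = (\<lambda>\<omega>. \<Sum>s<m. R ^ (k - m) * lot \<alpha> R (P \<omega>) m (held_before m (N' \<omega> s)) s)"
        unfolding V_def cash_out_def using m by (intro ext sum.cong lot_held_before_late) auto
      moreover have "(\<lambda>\<omega>. held_before m (N' \<omega> s) u) \<in> borel_measurable (F m)" if "s \<le> u" "u \<le> m" for s u
        using N'_meas[OF that] by (simp add: held_before_def)
      ultimately show ?thesis
        by (simp only:) (intro borel_measurable_sum borel_measurable_times borel_measurable_const
            borel_measurable_lot P_meas; simp)
    qed
    have W_meas: "W \<in> borel_measurable (F m)"
      unfolding W_def by (intro borel_measurable_sum borel_measurable_times N'_meas P_meas) auto
    have V_meas': "V \<in> borel_measurable (F (Suc m))"
      by (rule borel_measurable_filtration_mono[OF filt V_meas]) (use m in auto)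
    have basics: "AE \<omega> in M. liquidated_strategy (Suc k) (N' \<omega>) \<and> (\<forall>u\<le>k. 0 \<le> P \<omega> u) \<and>
        0 \<le> y \<omega> \<and> 0 \<le> S m \<omega> \<and> 0 \<le> A \<omega> \<and> 0 \<le> W \<omega>"
      using N_valid P_nn S_nn A \<eta>_nn
    proof eventually_elim
      case (elim \<omega>)
      then have "0 \<le> W \<omega>"
        unfolding W_def using m
        by (intro sum_nonneg mult_nonneg_nonneg) (auto simp: liquidated_strategy_def)
      with elim show ?case
        using R by (auto simp: y_def x_def)
    qed
    have rebuy: "A \<omega> + R * ((1 - \<alpha>) * R ^ (k - m) - y \<omega> * (R ^ (k - m) - \<alpha>)) * W \<omega>
        \<le> R * (account \<alpha> R (P \<omega>) (merged m (y \<omega>) c 0 1 (N' \<omega>)) k + (1 - c) * V \<omega>)"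
      if "liquidated_strategy (Suc k) (N' \<omega>)" "\<forall>u\<le>k. 0 \<le> P \<omega> u" "0 \<le> y \<omega>" for \<omega> c
      unfolding A_def W_def V_def using that m R assms(2,3) by (intro account_rebuy) auto

    have debt: "AE \<omega> in M. 0 < S m \<omega> \<and> return \<omega> < kappa \<alpha> r (Suc m) (Suc k) \<and> V \<omega> \<le> 0 \<longrightarrow>
        V \<omega> = 0 \<and> W \<omega> = 0"
    proof -
      let ?E = "\<lambda>\<omega>. 0 < S m \<omega> \<and> return \<omega> < kappa \<alpha> r (Suc m) (Suc k) \<and> V \<omega> \<le> 0"
      \<comment> \<open>With \<open>c = h = 0\<close> there is no trade before \<open>m\<close> or
        outside \<open>?E\<close>; on \<open>?E\<close> the shares are bought on credit. This
        indicator uses the return of the period, which is known at \<open>m\<close> in the model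
        without it.\<close>
      define l where "l = (\<lambda>\<omega>. if ?E \<omega> then 1 else 0 :: real)"
      define B where "B = (\<lambda>\<omega>. account \<alpha> R (P \<omega>) (merged m (y \<omega>) 0 0 (l \<omega>) (N' \<omega>)) k)"
      have l_meas: "l \<in> borel_measurable (F (Suc m))"
        unfolding l_def using S_meas(2) return_meas(1) V_meas' by measurable
      have gain: "- V \<omega> + ((1 - \<alpha>) * R ^ (k - m) - y \<omega> * (R ^ (k - m) - \<alpha>)) * W \<omega> \<le> B \<omega>
          \<and> 0 < (1 - \<alpha>) * R ^ (k - m) - y \<omega> * (R ^ (k - m) - \<alpha>)"
        if "liquidated_strategy (Suc k) (N' \<omega>)" "\<forall>u\<le>k. 0 \<le> P \<omega> u" "0 \<le> y \<omega>" "0 \<le> A \<omega>" "?E \<omega>" for \<omega>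
      proof
        \<comment> \<open>This is \<open>rebuy\<close> with \<open>c = 0\<close>, after dropping the
          nonnegative final wealth \<open>A\<close> of the given arbitrage.\<close>
        have "R * (- V \<omega> + ((1 - \<alpha>) * R ^ (k - m) - y \<omega> * (R ^ (k - m) - \<alpha>)) * W \<omega>) \<le> R * B \<omega>"
          using rebuy[OF that(1-3), of 0] that(4,5) by (simp add: B_def l_def algebra_simps)
        then show "- V \<omega> + ((1 - \<alpha>) * R ^ (k - m) - y \<omega> * (R ^ (k - m) - \<alpha>)) * W \<omega> \<le> B \<omega>"
          using R by (simp only: mult_le_cancel_left_pos)
        show "0 < (1 - \<alpha>) * R ^ (k - m) - y \<omega> * (R ^ (k - m) - \<alpha>)"
          using rebuy_profit[OF assms(2-4), of "S m \<omega>" "S (Suc m) \<omega>" m k] that(5)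
          by (simp add: y_def x_def R_def return_def)
      qed
      have "AE \<omega> in M. B \<omega> = 0"
        unfolding B_def R_def P_def
      proof (rule elim_no_arbitrage_account[OF filt m adapted NA])
        show "(\<lambda>\<omega>. merged m (y \<omega>) 0 0 (l \<omega>) (N' \<omega>) s u) \<in> borel_measurable (F (if u < m then u else Suc u))"
          if "s \<le> u" "u \<le> k" for s u
          unfolding N'_def
          using borel_measurable_merged[where N = N, OF filt N_meas y_meas _ l_meas that, of "\<lambda>_. 0" 0]
          by simp
        show "AE \<omega> in M. liquidated_strategy k (merged m (y \<omega>) 0 0 (l \<omega>) (N' \<omega>))"
          using basics by eventually_elim (intro liquidated_strategy_merged; auto simp: m l_def)
        show "AE \<omega> in M. 0 \<le> account \<alpha> (1 + (1 - \<alpha>) * r) (\<lambda>u. S' (skip m u) \<omega>)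
            (merged m (y \<omega>) 0 0 (l \<omega>) (N' \<omega>)) k"
          unfolding R_def[symmetric] P_def[symmetric]
          using basics
        proof eventually_elim
          case (elim \<omega>)
          have "0 \<le> B \<omega>"
          proof (cases "?E \<omega>")
            case True
            from gain[OF _ _ _ _ this] elim
            have "- V \<omega> + ((1 - \<alpha>) * R ^ (k - m) - y \<omega> * (R ^ (k - m) - \<alpha>)) * W \<omega> \<le> B \<omega>"
              "0 \<le> ((1 - \<alpha>) * R ^ (k - m) - y \<omega> * (R ^ (k - m) - \<alpha>)) * W \<omega>"
              by (auto intro: mult_nonneg_nonneg less_imp_le)
            then show ?thesis using True by linarith
          next
            case False
            then have "l \<omega> = 0" by (auto simp: l_def)
            then show ?thesis by (simp add: B_def account_cash_out[OF m])
          qed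
          then show ?case by (simp add: B_def P_def)
        qed
      qed
      then show ?thesis
        using basics
      proof eventually_elim
        case (elim \<omega>)
        show ?case
        proof
          assume E: "?E \<omega>"
          from gain[OF _ _ _ _ this] elim
          have K: "- V \<omega> + ((1 - \<alpha>) * R ^ (k - m) - y \<omega> * (R ^ (k - m) - \<alpha>)) * W \<omega> \<le> 0"
            "0 < (1 - \<alpha>) * R ^ (k - m) - y \<omega> * (R ^ (k - m) - \<alpha>)" and W: "0 \<le> W \<omega>"
            by auto
          then have "0 \<le> ((1 - \<alpha>) * R ^ (k - m) - y \<omega> * (R ^ (k - m) - \<alpha>)) * W \<omega>"
            by (intro mult_nonneg_nonneg) auto
          then have "V \<omega> = 0" "((1 - \<alpha>) * R ^ (k - m) - y \<omega> * (R ^ (k - m) - \<alpha>)) * W \<omega> = 0"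
            using K(1) E by linarith+
          then show "V \<omega> = 0 \<and> W \<omega> = 0"
            using K(2) by auto
        qed
      qed
    qed

    have wealth: "AE \<omega> in M. R < x \<omega> \<longrightarrow> 0 < V \<omega> \<or> V \<omega> = 0 \<and> W \<omega> = 0"
    proof -
      \<comment> \<open>The bad event, known at \<open>m\<close>. By \<open>debt\<close> the return
        is almost surely at least \<open>kappa\<close> on it, so the first alternative of the
        hypothesis fails there, and the second bounds the return by
        \<open>(1 - \<alpha>) * r\<close>, that is \<open>x \<le> R\<close>.\<close>
      define Z where "Z = {\<omega> \<in> space (F m). 0 < S m \<omega> \<and> (V \<omega> < 0 \<or> V \<omega> = 0 \<and> W \<omega> \<noteq> 0)}"
      have Z: "Z \<in> sets (F m)"
        unfolding Z_def using S_meas(1) V_meas W_meas by measurable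
      have sub: "subalgebra M (F m)" and space: "space (F m) = space M"
        using filt m by (auto simp: filtered_prob_space_def subalgebra_def)
      have pred: "Measurable.pred M (\<lambda>\<omega>. return \<omega> < kappa \<alpha> r (Suc m) (Suc k))"
        "Measurable.pred M (\<lambda>\<omega>. return \<omega> \<le> (1 - \<alpha>) * r)"
        using return_meas(2) by measurable
      have "AE \<omega> in M. \<omega> \<in> Z \<longrightarrow> \<not> return \<omega> < kappa \<alpha> r (Suc m) (Suc k)"
        using debt by eventually_elim (auto simp: Z_def)
      then have "AE \<omega> in M. \<omega> \<in> Z \<longrightarrow>
          cond_probability M (F m) (\<lambda>\<omega>. return \<omega> < kappa \<alpha> r (Suc m) (Suc k)) \<omega> = 0"
        by (rule cond_probability_eq_0[OF prob_space_axioms sub Z pred(1)])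
      then have "AE \<omega> in M. \<omega> \<in> Z \<longrightarrow> cond_probability M (F m) (\<lambda>\<omega>. return \<omega> \<le> (1 - \<alpha>) * r) \<omega> = 1"
        using assms(9)[unfolded T t diff_Suc_1, folded return_def] unfolding return_def
        by eventually_elim auto
      then have "AE \<omega> in M. \<omega> \<in> Z \<longrightarrow> return \<omega> \<le> (1 - \<alpha>) * r"
        by (rule cond_probability_eq_1[OF prob_space_axioms sub Z pred(2)])
      then show ?thesis
        using S_nn(1) AE_space
      proof eventually_elim
        case (elim \<omega>)
        show ?case
        proof (intro impI)
          assume x: "R < x \<omega>"
          \<comment> \<open>Division by zero gives \<open>x = 0\<close> where \<open>S m\<close>
            vanishes, which is incompatible with \<open>R < x\<close>.\<close>
          then have "S m \<omega> \<noteq> 0" using R by (auto simp: x_def)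
          then have "0 < S m \<omega>" "return \<omega> = x \<omega> - 1"
            using elim by (auto simp: return_def x_def diff_divide_distrib)
          then have "\<omega> \<notin> Z"
            using elim x by (auto simp: R_def)
          then show "0 < V \<omega> \<or> V \<omega> = 0 \<and> W \<omega> = 0"
            using \<open>0 < S m \<omega>\<close> elim by (auto simp: Z_def space)
        qed
      qed
    qed

    define h where "h = (\<lambda>\<omega>. if x \<omega> \<le> R then 1 else 0 :: real)"
    define l where "l = (\<lambda>\<omega>. if R < x \<omega> \<and> V \<omega> \<le> 0 then 1 else 0 :: real)"
    define B where "B = (\<lambda>\<omega>. account \<alpha> R (P \<omega>) (merged m (y \<omega>) 1 (h \<omega>) (l \<omega>) (N' \<omega>)) k)"
    have hl_meas: "h \<in> borel_measurable (F (Suc m))" "l \<in> borel_measurable (F (Suc m))"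
      unfolding h_def l_def using x_meas V_meas' by measurable
    \<comment> \<open>Dominance of \<open>A\<close> by \<open>R * B\<close> is not claimed when
      cashing out. The implication is enough: no-arbitrage forces \<open>B = 0\<close>, hence
      \<open>A \<le> 0\<close>, against the assumed arbitrage.\<close>
    have B_ge: "AE \<omega> in M. 0 \<le> B \<omega> \<and> (B \<omega> = 0 \<longrightarrow> A \<omega> \<le> 0)"
      using basics wealth
    proof eventually_elim
      case (elim \<omega>)
      consider "x \<omega> \<le> R" | "R < x \<omega>" "0 < V \<omega>" | "R < x \<omega>" "V \<omega> = 0" "W \<omega> = 0"
        using elim by fastforce
      then show ?case
      proof cases
        case 1
        then have "A \<omega> \<le> R * B \<omega>"
          unfolding A_def B_def h_def l_def using elim m R assms(2,3) y_le[of \<omega>]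
          by (auto intro!: account_hold)
        then have "0 \<le> R * B \<omega>" and "B \<omega> = 0 \<longrightarrow> A \<omega> \<le> 0"
          using elim by auto
        then show ?thesis
          using R by (auto simp: zero_le_mult_iff)
      next
        case 2
        then have "B \<omega> = V \<omega>"
          by (simp add: B_def h_def l_def V_def account_cash_out[OF m])
        then show ?thesis using 2 by simp
      next
        case 3
        \<comment> \<open>\<open>W = 0\<close> removes the term of \<open>rebuy\<close> whose
          constant may be negative for such large \<open>x\<close>, and \<open>c = 1\<close> removes
          the one with \<open>V\<close>.\<close>
        then have "A \<omega> \<le> R * B \<omega>"
          using rebuy[of \<omega> 1] elim by (simp add: B_def h_def l_def)
        then have "0 \<le> R * B \<omega>" and "B \<omega> = 0 \<longrightarrow> A \<omega> \<le> 0"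
          using elim by auto
        then show ?thesis
          using R by (auto simp: zero_le_mult_iff)
      qed
    qed
    have "AE \<omega> in M. B \<omega> = 0"
      unfolding B_def R_def P_def
    proof (rule elim_no_arbitrage_account[OF filt m adapted NA])
      show "(\<lambda>\<omega>. merged m (y \<omega>) 1 (h \<omega>) (l \<omega>) (N' \<omega>) s u) \<in> borel_measurable (F (if u < m then u else Suc u))"
        if "s \<le> u" "u \<le> k" for s u
        unfolding N'_def
        by (rule borel_measurable_merged[where N = N, OF filt N_meas y_meas hl_meas that])
      show "AE \<omega> in M. liquidated_strategy k (merged m (y \<omega>) 1 (h \<omega>) (l \<omega>) (N' \<omega>))"
        using basics
        by eventually_elim (intro liquidated_strategy_merged; auto simp: m l_def h_def y_le)
      show "AE \<omega> in M. 0 \<le> account \<alpha> (1 + (1 - \<alpha>) * r) (\<lambda>u. S' (skip m u) \<omega>)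
          (merged m (y \<omega>) 1 (h \<omega>) (l \<omega>) (N' \<omega>)) k"
        using B_ge by eventually_elim (simp add: B_def R_def P_def)
    qed
    then have "AE \<omega> in M. \<not> 0 < \<eta> (Suc k) \<omega>"
      using B_ge A by eventually_elim auto
    moreover have "\<eta> (Suc k) \<in> borel_measurable M"
      using sf by (intro borel_measurable_filtration[OF filt, of _ "Suc k"])
        (auto simp: self_financing_def)
    ultimately have "measure M {\<omega> \<in> space M. 0 < \<eta> (Suc k) \<omega>} = 0"
      by (subst prob_eq_0) auto
    then show False using \<eta>_pos by simp
  qed
  then show ?thesis
    unfolding robust_local_no_arbitrage_def using assms(8) by (auto simp: T t)
qed

end
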